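(* Let $N\ge2$, $1\le p<\infty$, let $T_1=B_{w_1},\dots,T_N=B_{w_N}$ be unilateral weighted shifts on $\ell^p(\mathbb{N})$, and let $\mathcal{A}$ be one of the families $\mathcal{A}_{uBd}$, $\mathcal{A}_{ud}$, $\mathcal{A}_{ld}$. Then $T_1,\dots,T_N$ are disjoint $\mathcal{A}$-hypercyclic if and only if there exist pairwise disjoint sets $A_k\in\mathcal{A}$, $k\ge1$, and a sequence $(\varepsilon_k)_{k\ge1}$ of positive real numbers tending to $0$ such that: (1) for any $s\in[N]$, $\sum_{n\ge1}\frac{1}{|W^s_{1,n}|^p}<\infty$; (2) for any $1\le j\le l$, any $k\ge1$, any $n\in A_k$, any $s\ne t\in[N]$, $\sum_{m\in A_l:\ m>n}\frac{|W^s_{j+m-n,n}|^p}{|W^t_{j,m}|^p}\le\varepsilon_l$; (3) for any $1\le j\le k<l$, any $n\in A_l$, any $s\ne t\in[N]$, $\sum_{m\in A_k:\ m>n}\frac{|W^s_{j+m-n,n}|^p}{|W^t_{j,m}|^p}\le\varepsilon_l$; (4) for any $l\ge1$, any scalars $(a_{s,j})_{s\in[N],j\in[l]}$ with all $a_{s,j}\ne0$, and any $\varepsilon>0$, there exists $L\ge l$ such that for every $s\ne t\in[N]$, every $n\in A_L$, every $j\in[l]$, $$\left|\frac{W^s_{j,n}}{W^t_{j,n}}-\frac{a_{s,j}}{a_{t,j}}\right|<\varepsilon.$$ Here $W^s_{l,n}=\prod_{\nu=1}^nw_{s,l+\nu}$ for all $s\in[N]$.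
   Context: $\mathbb{N}=\{1,2,\dots\}$, $[l]=\{1,\dots,l\}$; spaces are over $\mathbb{K}=\mathbb{R}$ or $\mathbb{C}$ with canonical basis $(e_n)_{n\ge1}$. For a bounded weight sequence $w=(w_n)_{n\ge1}$ of scalars, the unilateral weighted (backward) shift is $B_w(e_1)=0$, $B_w(e_n)=w_ne_{n-1}$ for $n\ge2$. We write $w_s=(w_{s,n})_{n\ge1}$. For $A\subset\mathbb{N}$: $\underline{\mathrm{dens}}\,A=\liminf_{M\to\infty}\frac{\mathrm{card}\{n\le M:n\in A\}}{M}$, $\overline{\mathrm{dens}}\,A=\limsup_{M\to\infty}\frac{\mathrm{card}\{n\le M:n\in A\}}{M}$, $\overline{\mathrm{Bd}}\,A=\limsup_{M\to\infty}\max_{k\ge1}\frac{\mathrm{card}(A\cap\{k+1,\dots,k+M\})}{M}$. $\mathcal{A}_{uBd},\mathcal{A}_{ud},\mathcal{A}_{ld}$ are the families of subsets of $\mathbb{N}$ of positive upper Banach density, positive upper density, positive lower density, respectively. $T_1,\dots,T_N$ are disjoint $\mathcal{A}$-hypercyclic if there is $x\in X$ (here $X=\ell^p(\mathbb{N})$) such that for all non-empty open $V_1,\dots,V_N\subset X$, $\{n:T_s^nx\in V_s\text{ for all }s\in[N]\}\in\mathcal{A}$. Convention: $1/0=+\infty$, so condition (1) includes the requirement that all $W^s_{1,n}$ are nonzero. *)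

theory Defs
  imports "HOL-Analysis.Analysis"
begin

section \<open>Densities\<close>

text \<open>
  Throughout, the positive integers are the subset \<open>{1..}\<close> of \<open>nat\<close>. Densities take values in
  \<open>ereal\<close>, where limits inferior and superior and suprema always exist. The value of the
  quotients at \<open>M = 0\<close> is irrelevant.
\<close>

definition lower_density :: "nat set \<Rightarrow> ereal" where
  "lower_density A = liminf (\<lambda>M. ereal (real (card (A \<inter> {1..M})) / real M))"

definition upper_density :: "nat set \<Rightarrow> ereal" where
  "upper_density A = limsup (\<lambda>M. ereal (real (card (A \<inter> {1..M})) / real M))"

text \<open>
  The supremum over \<open>k\<close> is a maximum, since the cardinalities lie in \<open>{0..M}\<close>.
\<close>

definition upper_Banach_density :: "nat set \<Rightarrow> ereal" where
  "upper_Banach_density A =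
     limsup (\<lambda>M. SUP k\<in>{1..}. ereal (real (card (A \<inter> {k+1..k+M})) / real M))"

definition family_ld :: "nat set set" where
  "family_ld = {A. A \<subseteq> {1..} \<and> lower_density A > 0}"

definition family_ud :: "nat set set" where
  "family_ud = {A. A \<subseteq> {1..} \<and> upper_density A > 0}"

definition family_uBd :: "nat set set" where
  "family_uBd = {A. A \<subseteq> {1..} \<and> upper_Banach_density A > 0}"


section \<open>Disjoint hypercyclicity along a family\<close>

definition disjoint_hypercyclic ::
  "nat set set \<Rightarrow> 'x topology \<Rightarrow> nat \<Rightarrow> (nat \<Rightarrow> 'x \<Rightarrow> 'x) \<Rightarrow> bool" where
  "disjoint_hypercyclic \<A> X N T \<longleftrightarrow>
     (\<exists>x\<in>topspace X. \<forall>V. (\<forall>s\<in>{1..N}. openin X (V s) \<and> V s \<noteq> {}) \<longrightarrow>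
        {n. 1 \<le> n \<and> (\<forall>s\<in>{1..N}. (T s ^^ n) x \<in> V s)} \<in> \<A>)"


section \<open>The sequence spaces\<close>

text \<open>
  A sequence indexed by the positive integers is represented by a function on \<open>nat\<close> that
  vanishes at \<open>0\<close>.
\<close>

definition lp_space :: "real \<Rightarrow> (nat \<Rightarrow> 'a::real_normed_vector) set" where
  "lp_space p = {x. x 0 = 0 \<and> summable (\<lambda>n. norm (x n) powr p)}"

definition lp_norm :: "real \<Rightarrow> (nat \<Rightarrow> 'a::real_normed_vector) \<Rightarrow> real" where
  "lp_norm p x = (\<Sum>n. norm (x n) powr p) powr (1 / p)"

definition lp_dist ::
  "real \<Rightarrow> (nat \<Rightarrow> 'a::real_normed_vector) \<Rightarrow> (nat \<Rightarrow> 'a) \<Rightarrow> real" where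
  "lp_dist p x y = lp_norm p (\<lambda>n. x n - y n)"

definition lp_topology :: "real \<Rightarrow> (nat \<Rightarrow> 'a::real_normed_vector) topology" where
  "lp_topology p = Metric_space.mtopology (lp_space p) (lp_dist p)"

lemma powr_convex_nonneg:
  fixes u v t p :: real
  assumes p: "p \<ge> 1" and u: "u \<ge> 0" and v: "v \<ge> 0" and t: "0 < t" "t < 1"
  shows "(t * u + (1 - t) * v) powr p \<le> t * u powr p + (1 - t) * v powr p"
proof -
  have scale: "(r * z) powr p \<le> r * z powr p" if "0 < r" "r < 1" "z \<ge> 0" for r z :: real
  proof -
    have "r powr p \<le> r powr 1"
      using that p by (intro powr_mono') auto
    then show ?thesis
      using that by (simp add: powr_mult mult_right_mono)
  qed
  show ?thesis
  proof (cases "u = 0 \<or> v = 0")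
    case True
    then show ?thesis
      using scale[of t u] scale[of "1 - t" v] u v t p by auto
  next
    case False
    then have "u \<in> {0<..}" "v \<in> {0<..}"
      using u v by auto
    then show ?thesis
      using convex_onD[OF powr_convex[OF p], of "1 - t" u v] t by simp
  qed
qed

lemma Minkowski_series:
  fixes f g :: "nat \<Rightarrow> real"
  assumes p: "p \<ge> 1" and f0: "\<And>n. f n \<ge> 0" and g0: "\<And>n. g n \<ge> 0"
    and f: "summable (\<lambda>n. f n powr p)" and g: "summable (\<lambda>n. g n powr p)"
  shows "summable (\<lambda>n. (f n + g n) powr p)"
    and "(\<Sum>n. (f n + g n) powr p) powr (1 / p)
         \<le> (\<Sum>n. f n powr p) powr (1 / p) + (\<Sum>n. g n powr p) powr (1 / p)"
proof -
  define a where "a = (\<Sum>n. f n powr p) powr (1 / p)"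
  define b where "b = (\<Sum>n. g n powr p) powr (1 / p)"
  have ab: "a \<ge> 0" "b \<ge> 0"
    by (simp_all add: a_def b_def)
  have ap: "a powr p = (\<Sum>n. f n powr p)" and bp: "b powr p = (\<Sum>n. g n powr p)"
    using p suminf_nonneg[OF f] suminf_nonneg[OF g] by (simp_all add: a_def b_def powr_powr)
  have zero: "h n = 0" if "(\<Sum>n. h n powr p) = 0" "summable (\<lambda>n. h n powr p)" for h :: "nat \<Rightarrow> real" and n
    using that suminf_eq_zero_iff[OF that(2)] by simp
  have "summable (\<lambda>n. (f n + g n) powr p) \<and>
        (\<Sum>n. (f n + g n) powr p) powr (1 / p) \<le> a + b"
  proof (cases "a = 0 \<or> b = 0")
    case True
    then have "(\<forall>n. f n = 0) \<or> (\<forall>n. g n = 0)"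
      using zero[of f] zero[of g] f g ap bp p by auto
    then show ?thesis
      using f g ab by (auto simp: a_def b_def)
  next
    case False
    then have pos: "a > 0" "b > 0"
      using ab by auto
    define t where "t = a / (a + b)"
    have t: "0 < t" "t < 1" and t': "1 - t = b / (a + b)"
      using pos by (auto simp: t_def field_simps)
    define F where
      "F n = (a + b) powr p * (t * (f n / a) powr p + (1 - t) * (g n / b) powr p)" for n
    have le: "(f n + g n) powr p \<le> F n" for n
    proof -
      have "f n + g n = (a + b) * (t * (f n / a) + (1 - t) * (g n / b))"
        unfolding t' unfolding t_def using pos by (simp add: distrib_left)
      then have "(f n + g n) powr p
                 = (a + b) powr p * (t * (f n / a) + (1 - t) * (g n / b)) powr p"
        using pos t f0[of n] g0[of n] by (simp add: powr_mult)
      also have "\<dots> \<le> F n"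
        unfolding F_def using powr_convex_nonneg[OF p, of "f n / a" "g n / b" t] pos t f0 g0
        by (intro mult_left_mono) auto
      finally show ?thesis .
    qed
    have F_eq: "F n = (a + b) powr p *
                  (t / a powr p * f n powr p + (1 - t) / b powr p * g n powr p)" for n
      using pos f0[of n] g0[of n] by (simp add: F_def powr_divide)
    have sF: "summable F"
      unfolding F_eq[abs_def] using f g by (intro summable_mult summable_add)
    have "suminf F = (a + b) powr p *
                  (t / a powr p * (\<Sum>n. f n powr p) + (1 - t) / b powr p * (\<Sum>n. g n powr p))"
      unfolding F_eq[abs_def] using f g
      by (simp add: suminf_mult suminf_add[symmetric] summable_mult summable_add
               del: times_divide_eq_left)
    also have "\<dots> = (a + b) powr p"
      unfolding ap[symmetric] bp[symmetric] using pos by simp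
    finally have F: "suminf F = (a + b) powr p" .
    have s: "summable (\<lambda>n. (f n + g n) powr p)"
      by (rule summable_comparison_test_ev[OF _ sF]) (use le in auto)
    have "(\<Sum>n. (f n + g n) powr p) \<le> (a + b) powr p"
      using suminf_le[OF le s sF] F by simp
    then have "(\<Sum>n. (f n + g n) powr p) powr (1 / p) \<le> ((a + b) powr p) powr (1 / p)"
      using suminf_nonneg[OF s] p by (intro powr_mono2) auto
    then show ?thesis
      using s pos p by (simp add: powr_powr)
  qed
  then show "summable (\<lambda>n. (f n + g n) powr p)"
    and "(\<Sum>n. (f n + g n) powr p) powr (1 / p)
         \<le> (\<Sum>n. f n powr p) powr (1 / p) + (\<Sum>n. g n powr p) powr (1 / p)"
    by (auto simp: a_def b_def)
qed

lemma lp_add: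
  fixes x y :: "nat \<Rightarrow> 'a::real_normed_vector"
  assumes p: "p \<ge> 1" and x: "x \<in> lp_space p" and y: "y \<in> lp_space p"
  shows "(\<lambda>n. x n + y n) \<in> lp_space p"
    and "lp_norm p (\<lambda>n. x n + y n) \<le> lp_norm p x + lp_norm p y"
proof -
  have sx: "summable (\<lambda>n. norm (x n) powr p)" and sy: "summable (\<lambda>n. norm (y n) powr p)"
    using x y by (auto simp: lp_space_def)
  note M = Minkowski_series[OF p, of "\<lambda>n. norm (x n)" "\<lambda>n. norm (y n)", OF _ _ sx sy, simplified]
  have le: "norm (x n + y n) powr p \<le> (norm (x n) + norm (y n)) powr p" for n
    using p by (intro powr_mono2 norm_triangle_ineq) auto
  have s: "summable (\<lambda>n. norm (x n + y n) powr p)"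
    by (rule summable_comparison_test_ev[OF _ M(1)]) (use le in auto)
  then show "(\<lambda>n. x n + y n) \<in> lp_space p"
    using x y by (simp add: lp_space_def)
  have "(\<Sum>n. norm (x n + y n) powr p) powr (1 / p)
        \<le> (\<Sum>n. (norm (x n) + norm (y n)) powr p) powr (1 / p)"
    using p suminf_le[OF le s M(1)] suminf_nonneg[OF s] by (intro powr_mono2) auto
  then show "lp_norm p (\<lambda>n. x n + y n) \<le> lp_norm p x + lp_norm p y"
    using M(2) by (simp add: lp_norm_def)
qed

lemma lp_diff:
  fixes x y :: "nat \<Rightarrow> 'a::real_normed_vector"
  assumes "p \<ge> 1" "x \<in> lp_space p" "y \<in> lp_space p"
  shows "(\<lambda>n. x n - y n) \<in> lp_space p"
  using lp_add(1)[of p x "\<lambda>n. - y n"] assms by (simp add: lp_space_def)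

lemma Metric_space_lp:
  assumes p: "p \<ge> 1"
  shows "Metric_space (lp_space p :: (nat \<Rightarrow> 'a::real_normed_vector) set) (lp_dist p)"
proof
  fix x y :: "nat \<Rightarrow> 'a"
  show "0 \<le> lp_dist p x y"
    by (simp add: lp_dist_def lp_norm_def)
  show "lp_dist p x y = lp_dist p y x"
    by (simp add: lp_dist_def lp_norm_def norm_minus_commute)
next
  fix x y :: "nat \<Rightarrow> 'a"
  assume "x \<in> lp_space p" "y \<in> lp_space p"
  then have "summable (\<lambda>n. norm (x n - y n) powr p)"
    using lp_diff[OF p, of x y] by (simp add: lp_space_def)
  then show "lp_dist p x y = 0 \<longleftrightarrow> x = y"
    by (auto simp: lp_dist_def lp_norm_def suminf_eq_zero_iff)
next
  fix x y z :: "nat \<Rightarrow> 'a"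
  assume "x \<in> lp_space p" "y \<in> lp_space p" "z \<in> lp_space p"
  then show "lp_dist p x z \<le> lp_dist p x y + lp_dist p y z"
    using lp_add(2)[OF p lp_diff[OF p, of x y] lp_diff[OF p, of y z]]
    by (simp add: lp_dist_def)
qed

lemma topspace_lp_topology:
  assumes "p \<ge> 1"
  shows "topspace (lp_topology p :: (nat \<Rightarrow> 'a::real_normed_vector) topology) = lp_space p"
  unfolding lp_topology_def
  by (rule Metric_space.topspace_mtopology[OF Metric_space_lp[OF assms]])


section \<open>Weighted backward shifts\<close>

text \<open>
  The scalars form a \<open>real_normed_field\<close>; by the theorems of Frobenius and Gelfand--Mazur the
  only such fields, up to isometric isomorphism, are the real and the complex numbers.

  The continuous linear operator determined by \<open>e\<^sub>1 \<mapsto> 0\<close> and \<open>e\<^sub>n \<mapsto> w\<^sub>n e\<^sub>n\<^sub>-\<^sub>1\<close> for \<open>n \<ge> 2\<close>,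
  written in coordinates. The coordinate at \<open>0\<close>, which is not part of the sequence, stays \<open>0\<close>.
\<close>

definition backward_shift ::
  "(nat \<Rightarrow> 'a::real_normed_field) \<Rightarrow> (nat \<Rightarrow> 'a) \<Rightarrow> nat \<Rightarrow> 'a" where
  "backward_shift w x = (\<lambda>n. if n = 0 then 0 else w (n + 1) * x (n + 1))"

definition unit_seq :: "nat \<Rightarrow> nat \<Rightarrow> 'a::real_normed_field" where
  "unit_seq n = (\<lambda>i. if i = n then 1 else 0)"

lemma backward_shift_unit_seq_1: "backward_shift w (unit_seq 1) = (\<lambda>i. 0)"
  by (auto simp: backward_shift_def unit_seq_def)

lemma backward_shift_unit_seq:
  assumes "n \<ge> 2"
  shows "backward_shift w (unit_seq n) = (\<lambda>i. w n * unit_seq (n - 1) i)"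
  using assms by (auto simp: backward_shift_def unit_seq_def fun_eq_iff)

lemma backward_shift_lp_space:
  fixes w :: "nat \<Rightarrow> 'a::real_normed_field"
  assumes p: "p \<ge> 1" and w: "bounded (w ` {1..})" and x: "x \<in> lp_space p"
  shows "backward_shift w x \<in> lp_space p"
proof -
  obtain C where C: "\<And>n. n \<ge> 1 \<Longrightarrow> norm (w n) \<le> C"
    using w by (auto simp: bounded_iff)
  have C0: "C \<ge> 0"
    using C[of 1] norm_ge_zero[of "w 1"] by linarith
  have "summable (\<lambda>n. norm (x (n + 1)) powr p)"
    using x by (subst summable_iff_shift) (simp add: lp_space_def)
  then have s: "summable (\<lambda>n. C powr p * norm (x (n + 1)) powr p)"
    by (rule summable_mult)
  have "norm (backward_shift w x n) powr p \<le> C powr p * norm (x (n + 1)) powr p" for n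
  proof -
    have "norm (backward_shift w x n) \<le> C * norm (x (n + 1))"
      using C[of "n + 1"] C0 by (auto simp: backward_shift_def norm_mult intro!: mult_right_mono)
    then have "norm (backward_shift w x n) powr p \<le> (C * norm (x (n + 1))) powr p"
      using p by (intro powr_mono2) auto
    then show ?thesis
      using C0 by (simp add: powr_mult)
  qed
  then have "summable (\<lambda>n. norm (backward_shift w x n) powr p)"
    by (intro summable_comparison_test_ev[OF _ s]) auto
  then show ?thesis
    by (simp add: lp_space_def backward_shift_def)
qed

definition weight_prod :: "(nat \<Rightarrow> 'a::real_normed_field) \<Rightarrow> nat \<Rightarrow> nat \<Rightarrow> 'a" where
  "weight_prod w l n = (\<Prod>\<nu>=1..n. w (l + \<nu>))"

text \<open>
  The extended nonnegative number \<open>|W\<^sub>l\<^sub>,\<^sub>n|\<^sup>p\<close>. In \<open>ennreal\<close> one has \<open>1 / 0 = \<infinity>\<close>, and every sum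
  of nonnegative terms exists.
\<close>

definition weight_pow :: "real \<Rightarrow> (nat \<Rightarrow> 'a::real_normed_field) \<Rightarrow> nat \<Rightarrow> nat \<Rightarrow> ennreal" where
  "weight_pow p w l n = ennreal (norm (weight_prod w l n) powr p)"

end

theory Submission
  imports Defs
begin

text \<open>
  Write \<open>W\<^sup>s\<^sub>j\<^sub>,\<^sub>n\<close> for the product of the \<open>n\<close> weights of \<open>T\<^sub>s\<close> that follow the index \<open>j\<close>. Then \<open>(T\<^sub>s\<^sup>n
  x)\<^sub>j = W\<^sup>s\<^sub>j\<^sub>,\<^sub>n x\<^sub>j\<^sub>+\<^sub>n\<close>: all the shifts read the same coordinate of \<open>x\<close>, so the quotient of \<open>(T\<^sub>s\<^sup>n x)\<^sub>j\<close>
  and \<open>(T\<^sub>t\<^sup>n x)\<^sub>j\<close> is \<open>W\<^sup>s\<^sub>j\<^sub>,\<^sub>n / W\<^sup>t\<^sub>j\<^sub>,\<^sub>n\<close>, as soon as the latter coordinate is nonzero. If \<open>T\<^sub>s\<^sup>n x\<close> is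
  close to \<open>y\<^sub>s\<close> for all \<open>s\<close>, the quotients of weights are close to the quotients of coordinates of
  the \<open>y\<^sub>s\<close>; this is the clause on quotients of weights (\<open>ratios_dense\<close>). The sums over later times
  \<open>m\<close>, called cross sums below, measure the contribution to \<open>T\<^sub>s\<^sup>n x\<close> of those coordinates of \<open>x\<close>
  that \<open>T\<^sub>t\<close> needs at a later time \<open>m\<close>.

  Necessity. Take tuples of finitely supported vectors, the \<open>k\<close>-th one with support exactly
  \<open>{1..k}\<close>, such that the quotients of their coordinates approximate the quotients \<open>a\<^sub>s\<^sub>,\<^sub>j / a\<^sub>t\<^sub>,\<^sub>j\<close>
  of every finite table of nonzero scalars, and let \<open>A\<^sub>k\<close> be the set of times at which the orbits
  are \<open>\<delta>\<^sub>k\<close>-close to the \<open>k\<close>-th tuple. Only quotients of coordinates matter for the quotients of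
  weights, so the \<open>k\<close>-th tuple may be multiplied by a number \<open>R\<^sub>k\<close>, and \<open>R\<^sub>k\<close> is made to grow very
  fast (\<open>separated_targets\<close>). Then a time in \<open>A\<^sub>k\<close> cannot be followed within \<open>k\<close> steps by a time in
  \<open>A\<^sub>l\<close>, \<open>l \<le> k\<close>: a shift by at most \<open>k\<close> steps either brings an almost vanishing coordinate to
  place \<open>l\<close>, or leaves a first coordinate that is far too large. So in a cross sum over \<open>A\<^sub>l\<close> at a
  time of \<open>A\<^sub>k\<close> either only the \<open>\<delta>\<^sub>k\<close>-small tail of \<open>T\<^sub>s\<^sup>n x\<close> occurs, or \<open>k < l\<close> and the sum is
  divided by a power of the huge number \<open>R\<^sub>l\<close> (\<open>disjoint_hypercyclic_imp_separating\<close>). The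
  summability of the inverse weights comes from the visits \<open>A\<close> to a neighbourhood of \<open>e\<^sub>1\<close>: there
  the sums of \<open>1 / |W\<^sub>1\<^sub>,\<^sub>m\<^sub>-\<^sub>n|\<^sup>p\<close> over the later \<open>m \<in> A\<close> are bounded uniformly in \<open>n \<in> A\<close>, and every
  natural number is, up to a bounded error, a difference of many pairs of elements of \<open>A\<close>
  (\<open>summable_if_summable_over_differences\<close>). Since all three families consist of sets of positive
  upper Banach density, one argument serves for all of them.

  Sufficiency. A single term of a cross sum with \<open>j = 1\<close>, multiplied by the same term with \<open>s\<close> and
  \<open>t\<close> exchanged, is the inverse of \<open>|W\<^sup>s\<^sub>1\<^sub>,\<^sub>m\<^sub>-\<^sub>n W\<^sup>t\<^sub>1\<^sub>,\<^sub>m\<^sub>-\<^sub>n|\<^sup>p\<close>; as it is at most \<open>\<epsilon>\<^sup>2\<close> and the weights are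
  bounded, \<open>m - n\<close> is large (\<open>separating_gaps\<close>). Along a fast subsequence \<open>L\<^sub>i\<close>, and after the
  removal of initial segments, the sets \<open>B\<^sub>i \<subseteq> A\<^bsub>L i\<^esub>\<close> are therefore so sparse that the blocks \<open>m +
  1, \<dots>, m + len i\<close> with \<open>m \<in> B\<^sub>i\<close> are disjoint. Put \<open>x\<^sub>j\<^sub>+\<^sub>m = b\<^sub>j / W\<^sup>1\<^sub>j\<^sub>,\<^sub>m\<close> on them, \<open>b\<close> being the
  \<open>i\<close>-th target for \<open>T\<^sub>1\<close>. At a time \<open>n \<in> B\<^sub>i\<close> the block of \<open>n\<close> itself produces the target for \<open>T\<^sub>1\<close>
  exactly and the one for \<open>T\<^sub>s\<close> approximately, by the clause on quotients; the blocks before \<open>n\<close>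
  have disappeared; the blocks after \<open>n\<close> contribute cross sums if \<open>s \<noteq> 1\<close>, and a tail of the
  series of inverse weights if \<open>s = 1\<close> (\<open>universal_vector\<close>, \<open>separating_imp_universal_vector\<close>).
\<close>

section \<open>Families of sets of positive density\<close>

lemma limsup_pos_iff:
  fixes X :: "nat \<Rightarrow> ereal"
  shows "limsup X > 0 \<longleftrightarrow> (\<exists>c::real. c > 0 \<and> (\<exists>\<^sub>F M in sequentially. ereal c \<le> X M))"
proof -
  have "limsup X > 0 \<longleftrightarrow> (\<exists>y>0. \<exists>\<^sub>F M in sequentially. y \<le> X M)"
    unfolding not_le[symmetric] Limsup_le_iff frequently_def by auto
  also have "\<dots> \<longleftrightarrow> (\<exists>c::real. c > 0 \<and> (\<exists>\<^sub>F M in sequentially. ereal c \<le> X M))"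
  proof safe
    fix y :: ereal assume y: "0 < y" "\<exists>\<^sub>F M in sequentially. y \<le> X M"
    obtain c where "0 < ereal c" "ereal c < y"
      using y(1) ereal_dense2 by blast
    then show "\<exists>c::real. c > 0 \<and> (\<exists>\<^sub>F M in sequentially. ereal c \<le> X M)"
      using y(2) by (intro exI[of _ c]) (auto elim!: frequently_elim1)
  next
    fix c :: real assume "c > 0" "\<exists>\<^sub>F M in sequentially. ereal c \<le> X M"
    then show "\<exists>y>0. \<exists>\<^sub>F M in sequentially. y \<le> X M"
      by (intro exI[of _ "ereal c"]) auto
  qed
  finally show ?thesis .
qed

lemma liminf_pos_iff:
  fixes X :: "nat \<Rightarrow> ereal"
  shows "liminf X > 0 \<longleftrightarrow> (\<exists>c::real. c > 0 \<and> (\<forall>\<^sub>F M in sequentially. ereal c \<le> X M))"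
proof safe
  assume "liminf X > 0"
  then obtain c where c: "0 < ereal c" "ereal c < liminf X"
    using ereal_dense2 by blast
  then have "\<forall>\<^sub>F M in sequentially. ereal c < X M"
    using less_LiminfD by blast
  then show "\<exists>c::real. c > 0 \<and> (\<forall>\<^sub>F M in sequentially. ereal c \<le> X M)"
    using c by (intro exI[of _ c]) (auto elim!: eventually_mono)
next
  fix c :: real assume "c > 0" "\<forall>\<^sub>F M in sequentially. ereal c \<le> X M"
  then have "ereal c \<le> liminf X" "0 < ereal c"
    by (auto intro: Liminf_bounded)
  then show "liminf X > 0" by order
qed

lemma le_quotient_iff:
  "M > 0 \<Longrightarrow> ereal c \<le> ereal (real a / real M) \<longleftrightarrow> c * real M \<le> real a"
  by (simp add: field_simps)

text \<open>
  The next three lemmas remove the limits: membership says that a linear lower bound for the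
  counting function holds for all large \<open>M\<close>, or for infinitely many \<open>M\<close>, or for infinitely many
  \<open>M\<close> in some window of length \<open>M\<close>. In this form comparisons of sets need only cardinalities.
\<close>
lemma family_ld_iff:
  "A \<in> family_ld \<longleftrightarrow> A \<subseteq> {1..} \<and>
     (\<exists>c>0. \<forall>\<^sub>F M in sequentially. c * real M \<le> real (card (A \<inter> {1..M})))"
proof -
  have "(\<forall>\<^sub>F M in sequentially. ereal c \<le> ereal (real (card (A \<inter> {1..M})) / real M)) \<longleftrightarrow>
        (\<forall>\<^sub>F M in sequentially. c * real M \<le> real (card (A \<inter> {1..M})))" for c
    by (intro eventually_subst eventually_mono[OF eventually_gt_at_top[of 0]] le_quotient_iff)
  then show ?thesis
    by (simp add: family_ld_def lower_density_def liminf_pos_iff)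
qed

lemma frequently_subst:
  "\<forall>\<^sub>F n in F. P n = Q n \<Longrightarrow> (\<exists>\<^sub>F n in F. P n) = (\<exists>\<^sub>F n in F. Q n)"
  unfolding frequently_def by (subst eventually_subst[of "\<lambda>n. \<not> P n" "\<lambda>n. \<not> Q n"]) auto

lemma family_ud_iff:
  "A \<in> family_ud \<longleftrightarrow> A \<subseteq> {1..} \<and>
     (\<exists>c>0. \<exists>\<^sub>F M in sequentially. c * real M \<le> real (card (A \<inter> {1..M})))"
proof -
  have "(\<exists>\<^sub>F M in sequentially. ereal c \<le> ereal (real (card (A \<inter> {1..M})) / real M)) \<longleftrightarrow>
        (\<exists>\<^sub>F M in sequentially. c * real M \<le> real (card (A \<inter> {1..M})))" for c
    by (intro frequently_subst eventually_mono[OF eventually_gt_at_top[of 0]] le_quotient_iff)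
  then show ?thesis
    by (simp add: family_ud_def upper_density_def limsup_pos_iff)
qed

lemma family_uBd_iff:
  "A \<in> family_uBd \<longleftrightarrow> A \<subseteq> {1..} \<and>
     (\<exists>c>0. \<exists>\<^sub>F M in sequentially. \<exists>k\<ge>1. c * real M \<le> real (card (A \<inter> {k+1..k+M})))"
proof -
  let ?X = "\<lambda>M. SUP k\<in>{1..}. ereal (real (card (A \<inter> {k+1..k+M})) / real M)"
  have "(\<exists>c::real. c > 0 \<and> (\<exists>\<^sub>F M in sequentially. ereal c \<le> ?X M)) \<longleftrightarrow>
    (\<exists>c>0. \<exists>\<^sub>F M in sequentially. \<exists>k\<ge>1. c * real M \<le> real (card (A \<inter> {k+1..k+M})))"
    (is "?L \<longleftrightarrow> ?R")
  proof
    assume ?L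
    then obtain c :: real where c: "c > 0" "\<exists>\<^sub>F M in sequentially. ereal c \<le> ?X M"
      by auto
    have "\<exists>k\<ge>1. c / 2 * real M \<le> real (card (A \<inter> {k+1..k+M}))"
      if "M > 0" "ereal c \<le> ?X M" for M
    proof -
      have "ereal (c / 2) < ?X M"
        using c(1) by (intro order_less_le_trans[OF _ that(2)]) auto
      then obtain k where "k \<ge> 1" "ereal (c / 2) < ereal (real (card (A \<inter> {k+1..k+M})) / real M)"
        unfolding less_SUP_iff by auto
      then show ?thesis
        using le_quotient_iff[OF that(1), of "c/2"] less_imp_le by blast
    qed
    then have "\<exists>\<^sub>F M in sequentially. \<exists>k\<ge>1. c / 2 * real M \<le> real (card (A \<inter> {k+1..k+M}))"
      using frequently_eventually_frequently[OF c(2) eventually_gt_at_top[of 0]]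
      by (auto elim!: frequently_elim1)
    then show ?R
      using c(1) half_gt_zero by blast
  next
    assume ?R
    then obtain c where c: "c > 0"
      "\<exists>\<^sub>F M in sequentially. \<exists>k\<ge>1. c * real M \<le> real (card (A \<inter> {k+1..k+M}))"
      by auto
    have "ereal c \<le> ?X M" if "M > 0" "\<exists>k\<ge>1. c * real M \<le> real (card (A \<inter> {k+1..k+M}))" for M
      using that(2) le_quotient_iff[OF that(1), of c] by (force intro: SUP_upper2)
    then have "\<exists>\<^sub>F M in sequentially. ereal c \<le> ?X M"
      using frequently_eventually_frequently[OF c(2) eventually_gt_at_top[of 0]]
      by (auto elim!: frequently_elim1)
    then show ?L
      using c(1) by blast
  qed
  then show ?thesis
    by (simp add: family_uBd_def upper_Banach_density_def limsup_pos_iff)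
qed

lemma density_family_superset:
  assumes "\<A> \<in> {family_uBd, family_ud, family_ld}" "A \<in> \<A>" "A \<subseteq> B" "B \<subseteq> {1..}"
  shows "B \<in> \<A>"
proof -
  have le: "c * real M \<le> real (card (B \<inter> S))"
    if "c * real M \<le> real (card (A \<inter> S))" "finite S" for c M S
    using that card_mono[of "B \<inter> S" "A \<inter> S"] assms(3) by fastforce
  show ?thesis
    using assms(1)
  proof (elim insertE emptyE)
    assume F: "\<A> = family_uBd"
    show ?thesis
      using assms(2,4) unfolding F family_uBd_iff
      by (elim conjE exE, intro conjI exI) (auto elim!: frequently_elim1 intro!: le)
  next
    assume F: "\<A> = family_ud"
    show ?thesis
      using assms(2,4) unfolding F family_ud_iff
      by (auto elim!: frequently_elim1 intro!: le)
  next
    assume F: "\<A> = family_ld"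
    show ?thesis
      using assms(2,4) unfolding F family_ld_iff
      by (auto elim!: eventually_mono intro!: le)
  qed
qed

text \<open>
  Removing an initial segment costs a bounded number of elements, which half of the linear lower
  bound absorbs.
\<close>
lemma density_family_tail:
  assumes "\<A> \<in> {family_uBd, family_ud, family_ld}" "A \<in> \<A>"
  shows "A \<inter> {K..} \<in> \<A>"
proof -
  have le: "c / 2 * real M \<le> real (card ((A \<inter> {K..}) \<inter> S))"
    if "c * real M \<le> real (card (A \<inter> S))" "c > 0" "real M \<ge> 2 * real K / c" "finite S" for c M S
  proof -
    have "card (A \<inter> S) \<le> card ((A \<inter> {K..}) \<inter> S \<union> {..<K})"
      using that(4) by (intro card_mono) auto
    also have "\<dots> \<le> card ((A \<inter> {K..}) \<inter> S) + K"
      using card_Un_le[of "(A \<inter> {K..}) \<inter> S" "{..<K}"] by simp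
    finally have "c * real M \<le> real (card ((A \<inter> {K..}) \<inter> S)) + real K"
      using that(1) by linarith
    moreover have "real K \<le> c / 2 * real M"
      using that(2,3) by (simp add: field_simps)
    ultimately show ?thesis
      by (simp add: field_simps)
  qed
  have ev: "\<forall>\<^sub>F M in sequentially. real M \<ge> r" for r
    using filterlim_real_sequentially unfolding filterlim_at_top by auto
  show ?thesis
    using assms(1)
  proof (elim insertE emptyE)
    assume F: "\<A> = family_uBd"
    obtain c where c: "c > 0"
      "\<exists>\<^sub>F M in sequentially. \<exists>k\<ge>1. c * real M \<le> real (card (A \<inter> {k+1..k+M}))"
      using assms(2) unfolding F family_uBd_iff by auto
    have "\<exists>\<^sub>F M in sequentially. \<exists>k\<ge>1. c / 2 * real M \<le> real (card ((A \<inter> {K..}) \<inter> {k+1..k+M}))"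
      using frequently_eventually_frequently[OF c(2) ev[of "2 * real K / c"]]
      by (rule frequently_elim1) (use c le in blast)
    then show ?thesis
      using assms(2) c(1) half_gt_zero unfolding F family_uBd_iff by blast
  next
    assume F: "\<A> = family_ud"
    obtain c where c: "c > 0"
      "\<exists>\<^sub>F M in sequentially. c * real M \<le> real (card (A \<inter> {1..M}))"
      using assms(2) unfolding F family_ud_iff by auto
    have "\<exists>\<^sub>F M in sequentially. c / 2 * real M \<le> real (card ((A \<inter> {K..}) \<inter> {1..M}))"
      using frequently_eventually_frequently[OF c(2) ev[of "2 * real K / c"]]
      by (rule frequently_elim1) (use c le in blast)
    then show ?thesis
      using assms(2) c(1) half_gt_zero unfolding F family_ud_iff by blast
  next
    assume F: "\<A> = family_ld"
    obtain c where c: "c > 0"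
      "\<forall>\<^sub>F M in sequentially. c * real M \<le> real (card (A \<inter> {1..M}))"
      using assms(2) unfolding F family_ld_iff by auto
    have "\<forall>\<^sub>F M in sequentially. c / 2 * real M \<le> real (card ((A \<inter> {K..}) \<inter> {1..M}))"
      using eventually_conj[OF c(2) ev[of "2 * real K / c"]]
      by (rule eventually_mono) (use c le in blast)
    then show ?thesis
      using assms(2) c(1) half_gt_zero unfolding F family_ld_iff by blast
  qed
qed

lemma density_family_subset_uBd:
  assumes "\<A> \<in> {family_uBd, family_ud, family_ld}"
  shows "\<A> \<subseteq> family_uBd"
proof -
  have "family_ld \<subseteq> family_ud"
    unfolding family_ld_iff family_ud_iff subset_iff
    using eventually_frequently sequentially_bot by blast
  moreover have "family_ud \<subseteq> family_uBd"
  proof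
    fix A assume A: "A \<in> family_ud"
    have "A \<inter> {2..} \<in> family_ud"
      using A by (intro density_family_tail) auto
    then obtain c where c: "c > 0"
      "\<exists>\<^sub>F M in sequentially. c * real M \<le> real (card ((A \<inter> {2..}) \<inter> {1..M}))"
      unfolding family_ud_iff by auto
    have "card ((A \<inter> {2..}) \<inter> {1..M}) \<le> card (A \<inter> {1 + 1..1 + M})" for M
      by (intro card_mono) auto
    then have "c * real M \<le> real (card (A \<inter> {1 + 1..1 + M}))"
      if "c * real M \<le> real (card ((A \<inter> {2..}) \<inter> {1..M}))" for M
      using that by (meson of_nat_mono order_trans)
    then have "\<exists>\<^sub>F M in sequentially. \<exists>k\<ge>1. c * real M \<le> real (card (A \<inter> {k + 1..k + M}))"
      using c(2) by (elim frequently_elim1) blast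
    then show "A \<in> family_uBd"
      using A c(1) unfolding family_uBd_iff family_ud_iff by blast
  qed
  ultimately show ?thesis
    using assms by auto
qed

lemma infinite_if_uBd:
  assumes "A \<in> family_uBd"
  shows "infinite A"
proof
  assume "finite A"
  then obtain K where "A \<subseteq> {..<K}"
    using finite_nat_bounded by blast
  then have "A \<inter> {K..} = {}"
    by auto
  then have "{} \<in> family_uBd"
    using density_family_tail[of family_uBd A K] assms by auto
  then obtain c :: real where c: "c > 0" "\<exists>\<^sub>F M in sequentially. c * real M \<le> 0"
    unfolding family_uBd_iff by (auto elim!: frequently_elim1)
  have "\<forall>\<^sub>F M in sequentially. \<not> c * real M \<le> 0"
    using eventually_gt_at_top[of 0] by eventually_elim (use c in \<open>simp add: not_le\<close>)
  then show False
    using c(2) by (simp add: frequently_def)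
qed

section \<open>Differences in sets of positive upper Banach density\<close>

text \<open>
  The thickenings \<open>S g = {n. \<exists>i<g. n + i \<in> A}\<close> increase with \<open>g\<close>, so their upper Banach densities
  increase to some \<open>\<rho> \<le> 1\<close>. Choose \<open>g\<close> with density of \<open>S g\<close> nearly \<open>\<rho>\<close>. The union of \<open>S g\<close> with
  its translate by \<open>q\<close> lies in \<open>S (g + q)\<close>, whose density is again at most \<open>\<rho>\<close>; hence \<open>S g\<close> and
  its translate overlap in a proportion that depends neither on \<open>q\<close> nor on \<open>K\<close>. The window is the
  same for all \<open>q \<le> K\<close>, so that the overlaps can be added up.
\<close>
lemma uBd_recurrence:
  assumes A: "A \<in> family_uBd"
  shows "\<exists>\<eta>>0. \<exists>g. \<forall>K. \<exists>M>0. \<exists>k. \<forall>q\<le>K. \<eta> * real M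
           \<le> real (card ({n. \<exists>i<g. n + i \<in> A} \<inter> {n. \<exists>i<g. n + q + i \<in> A} \<inter> {k+1..k+M}))"
proof -
  define S where "S g = {n. \<exists>i<g. n + i \<in> A}" for g
  define rich where "rich B c \<longleftrightarrow>
    (\<exists>\<^sub>F M in sequentially. \<exists>k. c * real M \<le> real (card (B \<inter> {k+1..k+M})))" for B and c :: real
  \<comment> \<open>The supremum of \<open>R\<close> is the limit \<open>\<rho>\<close> of the upper Banach densities of the thickenings.\<close>
  define R where "R = {c. \<exists>g. rich (S g) c}"
  obtain c0 where c0: "c0 > 0"
    "\<exists>\<^sub>F M in sequentially. \<exists>k\<ge>1. c0 * real M \<le> real (card (A \<inter> {k+1..k+M}))"
    using A unfolding family_uBd_iff by auto
  have "S 1 = A"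
    by (auto simp: S_def)
  then have "rich (S 1) c0"
    using c0(2) unfolding rich_def by (auto elim!: frequently_elim1)
  then have c0R: "c0 \<in> R"
    unfolding R_def by blast
  have R1: "c \<le> 1" if "c \<in> R" for c
  proof -
    obtain g where "rich (S g) c"
      using \<open>c \<in> R\<close> R_def by auto
    then obtain M k where M: "M > 0" "c * real M \<le> real (card (S g \<inter> {k+1..k+M}))"
      using frequently_ex[OF frequently_eventually_frequently[OF _ eventually_gt_at_top[of 0]]]
      unfolding rich_def by blast
    have "card (S g \<inter> {k+1..k+M}) \<le> card {k+1..k+M}"
      by (intro card_mono) auto
    then have "real (card (S g \<inter> {k+1..k+M})) \<le> real M"
      by simp
    then have "c * real M \<le> 1 * real M"
      using M(2) by linarith
    then show ?thesis
      using M(1) by simp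
  qed
  then have bdd: "bdd_above R"
    by (auto simp: bdd_above_def)
  define \<rho> where "\<rho> = Sup R"
  have \<rho>: "\<rho> > 0"
    using cSup_upper[OF c0R bdd] c0(1) by (simp add: \<rho>_def)
  obtain c where c: "c \<in> R" "3/4 * \<rho> < c"
    using less_cSup_iff[of R "3/4 * \<rho>"] c0R bdd \<rho> by (auto simp: \<rho>_def)
  then obtain g where g: "rich (S g) c"
    unfolding R_def by auto
  have main: "\<exists>M>0. \<exists>k. \<forall>q\<le>K. \<rho> / 8 * real M \<le> real (card (S g \<inter> {n. \<exists>i<g. n + q + i \<in> A} \<inter> {k+1..k+M}))" for K
  proof -
    \<comment> \<open>In a window with at least \<open>3/4 \<rho> M\<close> points of \<open>S g\<close> and fewer than \<open>5/4 \<rho> M\<close> points of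
      \<open>S (g + K)\<close>, the overlap has at least \<open>1/4 \<rho> M - K\<close> points; \<open>K\<close> is lost at the end of the
      window.\<close>
    have "\<not> rich (S (g + K)) (5/4 * \<rho>)"
    proof
      assume "rich (S (g + K)) (5/4 * \<rho>)"
      then have "5/4 * \<rho> \<in> R"
        unfolding R_def by auto
      then show False
        using cSup_upper[OF _ bdd, of "5/4 * \<rho>"] \<rho> by (simp add: \<rho>_def)
    qed
    then have ev1: "\<forall>\<^sub>F M in sequentially. \<forall>k. real (card (S (g + K) \<inter> {k+1..k+M})) < 5/4 * \<rho> * real M"
      unfolding rich_def not_frequently by (simp add: not_le)
    have ev2: "\<forall>\<^sub>F M in sequentially. real M \<ge> 8 * real K / \<rho>"
      using filterlim_real_sequentially unfolding filterlim_at_top by auto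
    obtain M k where M: "M > 0" "real M \<ge> 8 * real K / \<rho>"
      "c * real M \<le> real (card (S g \<inter> {k+1..k+M}))"
      "\<forall>k. real (card (S (g + K) \<inter> {k+1..k+M})) < 5/4 * \<rho> * real M"
      using frequently_ex[OF frequently_eventually_frequently[OF g[unfolded rich_def]
            eventually_conj[OF eventually_gt_at_top[of 0] eventually_conj[OF ev1 ev2]]]]
      by auto
    have KM: "real K \<le> \<rho> / 8 * real M"
      using M(2) \<rho> by (simp add: field_simps)
    have "\<rho> / 8 * real M \<le> real (card (S g \<inter> {n. \<exists>i<g. n + q + i \<in> A} \<inter> {k+1..k+M}))"
      if q: "q \<le> K" for q
    proof -
      let ?I = "{k+1..k+M}"
      let ?X = "S g \<inter> ?I"
      let ?Y = "{n. \<exists>i<g. n + q + i \<in> A} \<inter> ?I"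
      have "card ?X \<le> card ((\<lambda>n. n + q) ` ?Y \<union> {k+1..k+q})"
      proof (intro card_mono subsetI)
        fix n assume n: "n \<in> ?X"
        show "n \<in> (\<lambda>n. n + q) ` ?Y \<union> {k+1..k+q}"
        proof (cases "n \<le> k + q")
          case False
          then have "n = (n - q) + q" "n - q \<in> ?Y"
            using n by (auto simp: S_def)
          then show ?thesis by blast
        qed (use n in auto)
      qed auto
      also have "\<dots> \<le> card ((\<lambda>n. n + q) ` ?Y) + card {k+1..k+q}"
        by (rule card_Un_le)
      also have "card ((\<lambda>n. n + q) ` ?Y) = card ?Y"
        by (intro card_image) auto
      finally have Y: "real (card ?X) \<le> real (card ?Y) + real K"
        using q by simp
      have "real (card ?X) + real (card ?Y) = real (card (?X \<union> ?Y)) + real (card (?X \<inter> ?Y))"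
        using card_Un_Int[of ?X ?Y] by simp
      also have "card (?X \<union> ?Y) \<le> card (S (g + K) \<inter> ?I)"
      proof (intro card_mono subsetI)
        fix n assume "n \<in> ?X \<union> ?Y"
        then consider i where "i < g" "n + i \<in> A" "n \<in> ?I" | i where "i < g" "n + q + i \<in> A" "n \<in> ?I"
          by (auto simp: S_def)
        then show "n \<in> S (g + K) \<inter> ?I"
        proof cases
          case (1 i)
          then show ?thesis by (auto simp: S_def intro!: exI[of _ i])
        next
          case (2 i)
          then show ?thesis using q by (auto simp: S_def add.assoc intro!: exI[of _ "q + i"])
        qed
      qed auto
      finally have "real (card ?X) + real (card ?Y) \<le> 5/4 * \<rho> * real M + real (card (?X \<inter> ?Y))"
        using M(4)[rule_format, of k] by simp
      moreover have "3/4 * \<rho> * real M \<le> real (card ?X)"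
        using M(3) mult_right_mono[of "3/4 * \<rho>" c "real M"] c(2) by simp
      ultimately have "\<rho> / 8 * real M \<le> real (card (?X \<inter> ?Y))"
        using Y KM by linarith
      moreover have "?X \<inter> ?Y = S g \<inter> {n. \<exists>i<g. n + q + i \<in> A} \<inter> ?I"
        by auto
      ultimately show ?thesis by simp
    qed
    then show ?thesis
      using M(1) by blast
  qed
  show ?thesis
  proof (intro exI[of _ "\<rho> / 8"] conjI)
    show "\<exists>g. \<forall>K. \<exists>M>0. \<exists>k. \<forall>q\<le>K. \<rho> / 8 * real M
           \<le> real (card ({n. \<exists>i<g. n + i \<in> A} \<inter> {n. \<exists>i<g. n + q + i \<in> A} \<inter> {k+1..k+M}))"
      by (rule exI[of _ g], rule allI, rule main[unfolded S_def])
  qed (use \<rho> in simp)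
qed

lemma le_power_mult_if_le_mult_Suc:
  fixes \<alpha> :: "nat \<Rightarrow> real"
  assumes "\<And>k. \<alpha> k \<le> C * \<alpha> (Suc k)" "C \<ge> 1"
  shows "\<alpha> k \<le> C ^ r * \<alpha> (k + r)"
proof (induction r)
  case (Suc r)
  have "C ^ r * \<alpha> (k + r) \<le> C ^ r * (C * \<alpha> (Suc (k + r)))"
    using assms by (intro mult_left_mono) auto
  then show ?case
    using Suc by (simp add: mult_ac)
qed simp

text \<open>
  By recurrence every \<open>q\<close> is within \<open>g\<close> of a difference \<open>m - n\<close> of elements of \<open>A\<close> for a positive
  proportion of the \<open>n\<close> in a long window, and the growth condition on \<open>\<alpha>\<close> replaces \<open>\<alpha> q\<close> by the
  value at this difference at the cost of a constant factor. Summing over \<open>q\<close> and \<open>n\<close> and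
  exchanging the sums, the assumption bounds the total by a multiple of the length of the window,
  which cancels.
\<close>
lemma summable_if_summable_over_differences:
  fixes \<alpha> :: "nat \<Rightarrow> real"
  assumes A: "A \<in> family_uBd" and \<alpha>0: "\<And>k. \<alpha> k \<ge> 0"
    and step: "\<And>k. \<alpha> k \<le> C * \<alpha> (Suc k)" and C: "C \<ge> 1"
    and bound: "\<And>n F. n \<in> A \<Longrightarrow> finite F \<Longrightarrow> F \<subseteq> {m \<in> A. n < m} \<Longrightarrow> (\<Sum>m\<in>F. \<alpha> (m - n)) \<le> B"
  shows "summable \<alpha>"
proof -
  obtain \<eta> g where \<eta>: "\<eta> > 0"
    and rec: "\<forall>K. \<exists>M>0. \<exists>k. \<forall>q\<le>K. \<eta> * real M
           \<le> real (card ({n. \<exists>i<g. n + i \<in> A} \<inter> {n. \<exists>i<g. n + q + i \<in> A} \<inter> {k+1..k+M}))"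
    using uBd_recurrence[OF A] by (elim exE conjE)
  have "A \<noteq> {}"
    using infinite_if_uBd[OF A] by auto
  then obtain a where "a \<in> A"
    by blast
  then have B0: "B \<ge> 0"
    using bound[of a "{}"] by simp
  define D where "D = C ^ (2 * g)"
  have D0: "D \<ge> 0"
    using C by (simp add: D_def)
  have "(\<Sum>r<K. \<alpha> (r + 1)) \<le> D * real g * real g * B / \<eta>" for K
  proof -
    obtain M k where M: "M > 0" and Mk: "\<And>q. q \<le> K + g \<Longrightarrow> \<eta> * real M
           \<le> real (card ({n. \<exists>i<g. n + i \<in> A} \<inter> {n. \<exists>i<g. n + q + i \<in> A} \<inter> {k+1..k+M}))"
      using rec[rule_format, of "K + g"] by blast
    let ?I = "{k+1..k+M}"
    \<comment> \<open>The recurrence is applied to \<open>q = r + 1 + g\<close>: this \<open>q\<close> exceeds \<open>i\<close>, so that \<open>n + q + j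
      > n + i\<close>, and the difference of these two points is at least \<open>r + 1\<close>.\<close>
    define \<psi> where "\<psi> n r i j = (if n + i \<in> A \<and> n + (r + 1 + g) + j \<in> A
                         then \<alpha> ((n + (r + 1 + g) + j) - (n + i)) else 0)" for n r i j
    have \<psi>0: "\<psi> n r i j \<ge> 0" for n r i j
      by (simp add: \<psi>_def \<alpha>0)
    have one: "\<eta> * real M * \<alpha> (r + 1) \<le> D * (\<Sum>n\<in>?I. \<Sum>i<g. \<Sum>j<g. \<psi> n r i j)" if "r < K" for r
    proof -
      let ?J = "{n. \<exists>i<g. n + i \<in> A} \<inter> {n. \<exists>i<g. n + (r + 1 + g) + i \<in> A} \<inter> ?I"
      have each: "\<alpha> (r + 1) \<le> D * (\<Sum>i<g. \<Sum>j<g. \<psi> n r i j)" if n: "n \<in> ?J" for n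
      proof -
        obtain i j where ij: "i < g" "j < g" "n + i \<in> A" "n + (r + 1 + g) + j \<in> A"
          using n by blast
        let ?d = "(n + (r + 1 + g) + j) - (n + i)"
        have d: "?d = (r + 1) + (g + j - i)"
          using ij by auto
        have "\<alpha> (r + 1) \<le> C ^ (g + j - i) * \<alpha> ?d"
          unfolding d by (rule le_power_mult_if_le_mult_Suc[where \<alpha>=\<alpha>]) (fact step C)+
        also have "\<dots> \<le> D * \<alpha> ?d"
          using ij C unfolding D_def by (intro mult_right_mono power_increasing) (auto simp: \<alpha>0)
        also have "\<alpha> ?d = \<psi> n r i j"
          using ij by (simp add: \<psi>_def)
        also have "\<psi> n r i j \<le> (\<Sum>j<g. \<psi> n r i j)"
          using ij by (intro member_le_sum) (auto simp: \<psi>0)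
        also have "\<dots> \<le> (\<Sum>i<g. \<Sum>j<g. \<psi> n r i j)"
          using ij by (intro member_le_sum[where f="\<lambda>i. \<Sum>j<g. \<psi> n r i j"]) (auto simp: \<psi>0 sum_nonneg)
        finally show ?thesis
          using D0 by (simp add: mult_left_mono)
      qed
      have "\<eta> * real M * \<alpha> (r + 1) \<le> real (card ?J) * \<alpha> (r + 1)"
        using Mk[of "r + 1 + g"] that by (intro mult_right_mono) (auto simp: \<alpha>0)
      also have "\<dots> = (\<Sum>n\<in>?J. \<alpha> (r + 1))"
        by simp
      also have "\<dots> \<le> (\<Sum>n\<in>?J. D * (\<Sum>i<g. \<Sum>j<g. \<psi> n r i j))"
        using each by (intro sum_mono)
      also have "\<dots> \<le> (\<Sum>n\<in>?I. D * (\<Sum>i<g. \<Sum>j<g. \<psi> n r i j))"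
        using D0 by (intro sum_mono2) (auto intro!: mult_nonneg_nonneg sum_nonneg \<psi>0)
      finally show ?thesis
        by (simp add: sum_distrib_left)
    qed
    have three: "(\<Sum>r<K. \<psi> n r i j) \<le> B" if "i < g" for n i j
    proof (cases "n + i \<in> A")
      case True
      let ?R = "{r\<in>{..<K}. n + (r + 1 + g) + j \<in> A}"
      have "(\<Sum>r<K. \<psi> n r i j) = (\<Sum>r\<in>?R. \<alpha> ((n + (r + 1 + g) + j) - (n + i)))"
        unfolding \<psi>_def using True by (intro sum.mono_neutral_cong_right) auto
      also have "\<dots> = (\<Sum>m\<in>(\<lambda>r. n + (r + 1 + g) + j) ` ?R. \<alpha> (m - (n + i)))"
        by (subst sum.reindex) (auto simp: inj_on_def)
      also have "\<dots> \<le> B"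
        using that True by (intro bound) auto
      finally show ?thesis .
    qed (simp add: \<psi>_def B0)
    have swap: "(\<Sum>r<K. \<Sum>n\<in>?I. \<Sum>i<g. \<Sum>j<g. \<psi> n r i j) = (\<Sum>n\<in>?I. \<Sum>i<g. \<Sum>j<g. \<Sum>r<K. \<psi> n r i j)"
      by (rule trans[OF sum.swap], rule sum.cong[OF refl], rule trans[OF sum.swap],
          rule sum.cong[OF refl], rule sum.swap)
    have "\<eta> * real M * (\<Sum>r<K. \<alpha> (r + 1)) \<le> (\<Sum>r<K. D * (\<Sum>n\<in>?I. \<Sum>i<g. \<Sum>j<g. \<psi> n r i j))"
      unfolding sum_distrib_left[of "\<eta> * real M"] using one by (intro sum_mono) auto
    also have "\<dots> = D * (\<Sum>n\<in>?I. \<Sum>i<g. \<Sum>j<g. \<Sum>r<K. \<psi> n r i j)"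
      unfolding sum_distrib_left[symmetric]
      by (simp only: swap)
    also have "\<dots> \<le> D * (\<Sum>n\<in>?I. \<Sum>i<g. \<Sum>j<g. B)"
      using three D0 by (intro mult_left_mono sum_mono) auto
    also have "\<dots> = real M * (D * real g * real g * B)"
      by simp
    finally have "\<eta> * (\<Sum>r<K. \<alpha> (r + 1)) \<le> D * real g * real g * B"
      using M by (simp add: mult_ac)
    then show ?thesis
      using \<eta> by (simp add: field_simps)
  qed
  then have "summable (\<lambda>r. \<alpha> (r + 1))"
    by (intro summableI_nonneg_bounded) (auto simp: \<alpha>0)
  then show ?thesis
    by (subst (asm) summable_iff_shift)
qed

section \<open>Sums, quotients and dense sequences of scalars\<close>

text \<open>
  This translates the sums in the extended reals into real sums over finite sets, the form in
  which all estimates below are made.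
\<close>
lemma infsum_ennreal_le_iff:
  assumes "\<And>m. m \<in> S \<Longrightarrow> 0 \<le> f m" "0 \<le> c"
  shows "(\<Sum>\<^sub>\<infinity>m\<in>S. ennreal (f m)) \<le> ennreal c \<longleftrightarrow> (\<forall>F. finite F \<longrightarrow> F \<subseteq> S \<longrightarrow> sum f F \<le> c)"
proof -
  have "(\<Sum>\<^sub>\<infinity>m\<in>S. ennreal (f m)) = (SUP F\<in>{F. finite F \<and> F \<subseteq> S}. \<Sum>m\<in>F. ennreal (f m))"
    by (intro nonneg_infsum_complete) auto
  moreover have "(\<Sum>m\<in>F. ennreal (f m)) \<le> ennreal c \<longleftrightarrow> sum f F \<le> c" if "F \<subseteq> S" for F
    using assms that by (subst sum_ennreal) (auto intro: ennreal_le_iff)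
  ultimately show ?thesis
    by (auto simp: SUP_le_iff)
qed

lemma summable_tail_sums_small:
  fixes f :: "nat \<Rightarrow> real"
  assumes "summable f" "\<And>n. f n \<ge> 0" "e > 0"
  shows "\<exists>G. \<forall>F. finite F \<longrightarrow> F \<subseteq> {G..} \<longrightarrow> sum f F \<le> e"
proof -
  obtain G where G: "\<And>n. n \<ge> G \<Longrightarrow> norm (\<Sum>i. f (i + n)) < e"
    using suminf_exist_split[OF assms(3,1)] by blast
  have "sum f F \<le> e" if "finite F" "F \<subseteq> {G..}" for F
  proof -
    have "sum f F = (\<Sum>i\<in>(\<lambda>n. n - G) ` F. f (i + G))"
      by (rule sum.reindex_bij_witness[of _ "\<lambda>i. i + G" "\<lambda>n. n - G"]) (use that in auto)
    also have "\<dots> \<le> (\<Sum>i. f (i + G))"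
      using that assms by (intro sum_le_suminf) (auto simp: summable_iff_shift)
    also have "\<dots> \<le> e"
      using G[of G] by auto
    finally show ?thesis .
  qed
  then show ?thesis by blast
qed

lemma small_powr_exists:
  fixes S e p :: real
  assumes "S \<ge> 0" "e > 0" "p \<ge> 1"
  shows "\<exists>\<tau>>0. S * \<tau> powr p \<le> e"
proof (intro exI conjI)
  let ?\<tau> = "(e / (S + 1)) powr (1 / p)"
  show "?\<tau> > 0"
    using assms by simp
  have "?\<tau> powr p = e / (S + 1)"
    using assms by (simp add: powr_powr)
  moreover have "S * (e / (S + 1)) \<le> e"
    using assms by (simp add: field_simps)
  ultimately show "S * ?\<tau> powr p \<le> e"
    by (simp only:)
qed

text \<open>
  Continuity of the quotient, formulated as an eventual statement about the tolerance \<open>d\<close>, so that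
  finitely many instances can be combined with each other and with other smallness conditions.
\<close>
lemma eventually_quotient_close:
  fixes u0 v0 :: "'a::real_normed_field"
  assumes "v0 \<noteq> 0" "e > 0"
  shows "\<forall>\<^sub>F d in at_right 0. \<forall>u v. norm (u - u0) < d \<longrightarrow> norm (v - v0) < d \<longrightarrow> norm (u / v - u0 / v0) < e"
proof -
  have "((\<lambda>z. fst z / snd z) \<longlongrightarrow> fst (u0, v0) / snd (u0, v0)) (nhds (u0, v0))"
    using assms by (intro tendsto_intros filterlim_ident) auto
  then have "\<forall>\<^sub>F z in nhds (u0, v0). dist (fst z / snd z) (u0 / v0) < e"
    using assms(2) by (auto dest: tendstoD)
  then obtain d where d: "d > 0" "\<And>u v. dist (u, v) (u0, v0) < d \<Longrightarrow> dist (u / v) (u0 / v0) < e"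
    unfolding eventually_nhds_metric by fastforce
  have "norm (u / v - u0 / v0) < e" if "c < d / 2" "norm (u - u0) < c" "norm (v - v0) < c" for c u v
  proof -
    have "dist (u, v) (u0, v0) \<le> dist u u0 + dist v v0"
      unfolding dist_Pair_Pair by (rule sqrt_sum_squares_le_sum) auto
    also have "\<dots> < d"
      using that by (simp add: dist_norm)
    finally show ?thesis
      using d(2) by (simp add: dist_norm)
  qed
  moreover have "\<forall>\<^sub>F c in at_right 0. c < d / 2"
    using d(1) by (intro eventually_at_right_less[THEN eventually_mono] order_tendstoD(2)[OF tendsto_ident_at]) auto
  ultimately show ?thesis
    by (auto elim!: eventually_mono)
qed

lemma nonzero_dense_sequence:
  "\<exists>d :: nat \<Rightarrow> 'a::{real_normed_field, euclidean_space}.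
     (\<forall>n. d n \<noteq> 0) \<and> (\<forall>a e. e > 0 \<longrightarrow> (\<exists>n. norm (d n - a) < e))"
proof -
  obtain D :: "'a set" where D: "countable D" "\<And>X. open X \<Longrightarrow> X \<noteq> {} \<Longrightarrow> \<exists>d\<in>D. d \<in> X"
    using countable_dense_exists[where 'a='a] by metis
  have ex: "\<exists>d\<in>D - {0}. norm (d - a) < e" if "e > 0" for a e
  proof -
    have "ball a e - {0} \<noteq> {}"
    proof (cases "a = 0")
      case True
      have "of_real (e / 2) \<in> ball a e - {0}"
        using that True by simp
      then show ?thesis by blast
    next
      case False
      then have "a \<in> ball a e - {0}"
        using that by simp
      then show ?thesis by blast
    qed
    then obtain d where "d \<in> D" "d \<in> ball a e - {0}"
      using D(2)[of "ball a e - {0}"] by (auto simp: open_delete)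
    then show ?thesis
      by (auto simp: dist_norm norm_minus_commute)
  qed
  have ne: "D - {0} \<noteq> {}"
    using ex[of 1 0] by auto
  let ?d = "from_nat_into (D - {0})"
  have "?d n \<noteq> 0" for n
    using from_nat_into[OF ne, of n] by auto
  moreover have "\<exists>n. norm (?d n - a) < e" if "e > 0" for a e
    using ex[OF that, of a] D(1) from_nat_into_surj[of "D - {0}"] by (metis countable_Diff)
  ultimately show ?thesis
    by blast
qed

text \<open>
  A table \<open>b i\<close> assigns scalars to the positions \<open>(s, j)\<close>, and \<open>len i\<close> is the number of relevant
  columns. The index codes \<open>len i\<close>, a finite table of indices into a dense sequence, and an
  arbitrary number; the last component repeats every table infinitely often, which allows \<open>i \<ge> K\<close>.
\<close>
lemma nonzero_dense_tables:
  "\<exists>(b :: nat \<Rightarrow> nat \<Rightarrow> nat \<Rightarrow> 'a::{real_normed_field, euclidean_space}) (len :: nat \<Rightarrow> nat).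
     (\<forall>i s j. b i s j \<noteq> 0) \<and>
     (\<forall>l N a e K. e > 0 \<longrightarrow>
        (\<exists>i\<ge>K. len i = l \<and> (\<forall>s\<le>N. \<forall>j\<le>l. norm (b i s j - a s j) < e)))"
proof -
  obtain d :: "nat \<Rightarrow> 'a" where d0: "\<And>n. d n \<noteq> 0"
    and d: "\<And>a e. e > 0 \<Longrightarrow> \<exists>n. norm (d n - a) < e"
    using nonzero_dense_sequence by blast
  define len where "len i = fst (prod_decode (fst (prod_decode i)))" for i
  define tab where "tab i = (from_nat (snd (prod_decode (fst (prod_decode i)))) :: nat list list)" for i
  define b where "b i s j = d (tab i ! s ! j)" for i s j
  have "\<exists>i\<ge>K. len i = l \<and> (\<forall>s\<le>N. \<forall>j\<le>l. norm (b i s j - a s j) < e)" if "e > 0" for l N a e K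
  proof -
    have "\<forall>s j. \<exists>n. norm (d n - a s j) < e"
      using d \<open>e > 0\<close> by blast
    then obtain n where n: "\<forall>s j. norm (d (n s j) - a s j) < e"
      by metis
    define xss where "xss = map (\<lambda>s. map (n s) [0..<Suc l]) [0..<Suc N]"
    define i where "i = prod_encode (prod_encode (l, to_nat xss), K)"
    have "i \<ge> K"
      unfolding i_def by (rule le_prod_encode_2)
    moreover have "len i = l" "tab i = xss"
      by (simp_all add: len_def tab_def i_def)
    moreover have "xss ! s ! j = n s j" if "s \<le> N" "j \<le> l" for s j
      using that by (simp add: xss_def del: upt_Suc)
    ultimately show ?thesis
      using n by (intro exI[of _ i]) (auto simp: b_def)
  qed
  then show ?thesis
    using d0 by (intro exI[of _ b] exI[of _ len]) (auto simp: b_def)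
qed

lemma finite_positive_lower_bound:
  fixes f :: "'b \<Rightarrow> real"
  assumes "finite S" "\<And>z. z \<in> S \<Longrightarrow> f z > 0"
  shows "\<exists>c>0. c \<le> 1 \<and> (\<forall>z\<in>S. c \<le> f z)"
  using assms by (intro exI[of _ "Min (insert 1 (f ` S))"]) auto

text \<open>
  Recursion along \<open>k\<close>: only finitely many lower bounds are imposed at each stage.
\<close>
lemma fast_growing_sequence:
  fixes f :: "nat \<Rightarrow> real" and h :: "nat \<Rightarrow> nat \<Rightarrow> real \<Rightarrow> real"
  shows "\<exists>R. \<forall>k. R k \<ge> f k \<and> (\<forall>l<k. R k \<ge> h k l (R l))"
proof -
  have "\<exists>r. r \<ge> f k \<and> (\<forall>l<k. r \<ge> h k l (R l))" for k and R :: "nat \<Rightarrow> real"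
    by (intro exI[of _ "Max (insert (f k) ((\<lambda>l. h k l (R l)) ` {..<k}))"]) auto
  then show ?thesis
    by (intro dependent_wellorder_choice[where P="\<lambda>R k r. r \<ge> f k \<and> (\<forall>l<k. r \<ge> h k l (R l))"]) auto
qed

section \<open>Iterates of weighted shifts on sequence spaces\<close>

lemma weight_prod_add:
  "weight_prod w j (a + b) = weight_prod w j a * weight_prod w (j + a) b"
proof -
  have "{1..a + b} = {1..a} \<union> {a+1..a+b}" "{1..a} \<inter> {a+1..a+b} = {}"
    by auto
  then have "weight_prod w j (a + b) = (\<Prod>\<nu>=1..a. w (j + \<nu>)) * (\<Prod>\<nu>\<in>{a+1..a+b}. w (j + \<nu>))"
    unfolding weight_prod_def by (simp add: prod.union_disjoint)
  also have "(\<Prod>\<nu>\<in>{a+1..a+b}. w (j + \<nu>)) = (\<Prod>\<nu>=1..b. w (j + a + \<nu>))"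
    by (rule prod.reindex_bij_witness[of _ "\<lambda>\<nu>. \<nu> + a" "\<lambda>\<nu>. \<nu> - a"]) (auto simp: add_ac)
  finally show ?thesis
    by (simp add: weight_prod_def)
qed

lemma weight_prod_0 [simp]: "weight_prod w j 0 = 1"
  by (simp add: weight_prod_def)

lemma weight_prod_1: "weight_prod w j (Suc 0) = w (Suc j)"
  by (simp add: weight_prod_def)

lemma backward_shift_funpow:
  assumes "x 0 = 0"
  shows "(backward_shift w ^^ n) x j = (if j = 0 then 0 else weight_prod w j n * x (j + n))"
proof (induction n arbitrary: j)
  case (Suc n)
  have "weight_prod w j (Suc n) = w (Suc j) * weight_prod w (Suc j) n"
    using weight_prod_add[of w j 1 n] by (simp add: weight_prod_1)
  then show ?case
    using Suc[of "Suc j"] by (simp add: backward_shift_def)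
qed (use assms in auto)

lemma backward_shift_funpow_lp:
  fixes w :: "nat \<Rightarrow> 'a::real_normed_field"
  assumes "p \<ge> 1" "bounded (w ` {1..})" "x \<in> lp_space p"
  shows "(backward_shift w ^^ n) x \<in> lp_space p"
  using assms by (induction n) (auto intro: backward_shift_lp_space)

lemma lp_norm_nonneg: "lp_norm p x \<ge> 0"
  by (simp add: lp_norm_def)

lemma lp_norm_powr:
  assumes "p \<ge> 1" "x \<in> lp_space p"
  shows "lp_norm p x powr p = (\<Sum>n. norm (x n) powr p)"
  using assms by (auto simp: lp_norm_def lp_space_def powr_powr suminf_nonneg)

lemma lp_sum_le:
  assumes "p \<ge> 1" "x \<in> lp_space p" "finite F"
  shows "(\<Sum>i\<in>F. norm (x i) powr p) \<le> lp_norm p x powr p"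
  unfolding lp_norm_powr[OF assms(1,2)]
  using assms by (intro sum_le_suminf) (auto simp: lp_space_def)

lemma lp_coord_le:
  assumes "p \<ge> 1" "x \<in> lp_space p"
  shows "norm (x i) \<le> lp_norm p x"
proof -
  have "norm (x i) powr p \<le> lp_norm p x powr p"
    using lp_sum_le[OF assms, of "{i}"] by simp
  then show ?thesis
    using assms(1) lp_norm_nonneg[of p x] powr_less_mono2[of p "lp_norm p x" "norm (x i)"] by fastforce
qed

lemma lp_bounded_sums:
  assumes "p \<ge> 1" "x 0 = 0" "\<And>F. finite F \<Longrightarrow> (\<Sum>i\<in>F. norm (x i) powr p) \<le> c"
  shows "x \<in> lp_space p" "lp_norm p x powr p \<le> c"
proof -
  have "summable (\<lambda>n. norm (x n) powr p)"
    by (intro summableI_nonneg_bounded[where x=c]) (auto simp: assms)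
  then show *: "x \<in> lp_space p"
    using assms by (simp add: lp_space_def)
  show "lp_norm p x powr p \<le> c"
    unfolding lp_norm_powr[OF assms(1) *]
    using \<open>summable (\<lambda>n. norm (x n) powr p)\<close> assms by (intro suminf_le_const) auto
qed

lemma finite_support_in_lp_space:
  assumes "x 0 = 0" "finite {j. x j \<noteq> 0}"
  shows "x \<in> lp_space p"
proof -
  have "summable (\<lambda>n. norm (x n) powr p)"
    using assms(2) by (intro summable_finite[of "{j. x j \<noteq> 0}"]) auto
  then show ?thesis
    using assms by (simp add: lp_space_def)
qed

lemma lp_norm_scale:
  fixes x :: "nat \<Rightarrow> 'a::real_normed_field"
  assumes "p \<ge> 1" "x \<in> lp_space p" "r \<ge> 0"
  shows "lp_norm p (\<lambda>j. of_real r * x j) = r * lp_norm p x"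
proof -
  have "summable (\<lambda>n. norm (x n) powr p)"
    using assms by (simp add: lp_space_def)
  then show ?thesis
    using assms suminf_nonneg[of "\<lambda>n. norm (x n) powr p"]
    by (simp add: lp_norm_def norm_mult powr_mult suminf_mult powr_powr)
qed

section \<open>Tuples of weighted shifts and cross sums\<close>

locale shift_tuple =
  fixes N :: nat and p :: real and w :: "nat \<Rightarrow> nat \<Rightarrow> 'a::{real_normed_field, euclidean_space}"
  assumes N2: "N \<ge> 2" and p1: "1 \<le> p"
    and bounded_weights: "s \<in> {1..N} \<Longrightarrow> bounded (w s ` {1..})"
begin

abbreviation W :: "nat \<Rightarrow> nat \<Rightarrow> nat \<Rightarrow> 'a" where
  "W s \<equiv> weight_prod (w s)"

definition cross_sum :: "nat \<Rightarrow> nat \<Rightarrow> nat \<Rightarrow> nat \<Rightarrow> nat set \<Rightarrow> real" where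
  "cross_sum s t j n F = (\<Sum>m\<in>F. (norm (W s (j + m - n) n) / norm (W t j m)) powr p)"

lemma weight_prod_growth: "\<exists>C\<ge>1. \<forall>s\<in>{1..N}. \<forall>j n. norm (W s j n) \<le> C ^ n"
proof -
  have "bounded (\<Union>s\<in>{1..N}. w s ` {1..})"
    using bounded_weights by (intro bounded_UN) auto
  then obtain C where C: "\<forall>z\<in>(\<Union>s\<in>{1..N}. w s ` {1..}). norm z \<le> C"
    by (auto simp: bounded_iff)
  have "norm (W s j n) \<le> max 1 C ^ n" if "s \<in> {1..N}" for s j n
  proof -
    have "norm (W s j n) = (\<Prod>\<nu>=1..n. norm (w s (j + \<nu>)))"
      by (simp add: weight_prod_def prod_norm)
    also have "\<dots> \<le> (\<Prod>\<nu>=1..n. max 1 C)"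
      using C that by (intro prod_mono) (auto simp: max.coboundedI2)
    finally show ?thesis by simp
  qed
  then show ?thesis
    by (intro exI[of _ "max 1 C"]) auto
qed

lemma weight_prod_split:
  "1 \<le> j \<Longrightarrow> n \<le> m \<Longrightarrow> W s j m = W s j (m - n) * W s (j + m - n) n"
  using weight_prod_add[of "w s" j "m - n" n] by simp

lemma weight_prod_nonzero:
  assumes "\<forall>n. W s 1 n \<noteq> 0" "1 \<le> j"
  shows "W s j n \<noteq> 0"
  using assms(1)[rule_format, of "(j - 1) + n"] assms(2) weight_prod_add[of "w s" 1 "j - 1" n] by auto

text \<open>
  A finite value of the extended sum forces all \<open>W s 1 n\<close> to be nonzero, because \<open>1 / 0 = \<infinity>\<close>.
\<close>
lemma inverse_weights_summable_iff:
  "(\<Sum>\<^sub>\<infinity>n\<in>{1..}. 1 / weight_pow p (w s) 1 n) < \<infinity> \<longleftrightarrow>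
     (\<forall>n. W s 1 n \<noteq> 0) \<and> summable (\<lambda>n. 1 / norm (W s 1 n) powr p)" (is "?S < \<infinity> \<longleftrightarrow> ?R")
proof
  let ?f = "\<lambda>n. 1 / norm (W s 1 n) powr p"
  have eq: "?S = (\<Sum>\<^sub>\<infinity>n\<in>{1..}. ennreal (?f n))" if nz: "\<forall>n. W s 1 n \<noteq> 0"
    using nz by (intro infsum_cong) (simp add: weight_pow_def divide_ennreal flip: ennreal_1)
  {
    assume fin: "?S < \<infinity>"
    have "W s 1 n \<noteq> 0" for n
    proof (cases "n = 0")
      case False
      have "(\<Sum>n\<in>{n}. 1 / weight_pow p (w s) 1 n) \<le> ?S"
        unfolding nonneg_infsum_complete[OF zero_le] using False by (intro SUP_upper) auto
      then have "1 / weight_pow p (w s) 1 n \<noteq> \<infinity>"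
        using fin by auto
      then show ?thesis
        by (auto simp: weight_pow_def divide_ennreal_def)
    qed simp
    then have nz: "\<forall>n. W s 1 n \<noteq> 0"
      by blast
    obtain c where c: "c \<ge> 0" "?S = ennreal c"
      using fin by (cases ?S) auto
    have le_c: "\<forall>F. finite F \<longrightarrow> F \<subseteq> {1..} \<longrightarrow> sum ?f F \<le> c"
      using c eq[OF nz] infsum_ennreal_le_iff[of "{1..}" ?f c] by auto
    have "sum ?f ((\<lambda>n. n + 1) ` {..<K}) \<le> c" for K
      by (intro le_c[rule_format]) auto
    then have "(\<Sum>n<K. ?f (n + 1)) \<le> c" for K
      by (subst (asm) sum.reindex) auto
    then have "summable (\<lambda>n. ?f (n + 1))"
      by (intro summableI_nonneg_bounded) auto
    then show ?R
      using nz by (subst (asm) summable_iff_shift) auto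
  }
  assume R: ?R
  have "?S \<le> ennreal (\<Sum>n. ?f n)"
    using R eq by (simp add: infsum_ennreal_le_iff suminf_nonneg sum_le_suminf)
  then show "?S < \<infinity>"
    using order_le_less_trans ennreal_less_top by fastforce
qed

lemma cross_sum_le_iff:
  assumes "\<forall>m. W t j m \<noteq> 0" "c \<ge> 0"
  shows "(\<Sum>\<^sub>\<infinity>m\<in>{m \<in> A. m > n}. weight_pow p (w s) (j + m - n) n / weight_pow p (w t) j m) \<le> ennreal c
     \<longleftrightarrow> (\<forall>F. finite F \<longrightarrow> F \<subseteq> {m \<in> A. m > n} \<longrightarrow> cross_sum s t j n F \<le> c)"
proof -
  have "(\<Sum>\<^sub>\<infinity>m\<in>{m \<in> A. m > n}. weight_pow p (w s) (j + m - n) n / weight_pow p (w t) j m) =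
    (\<Sum>\<^sub>\<infinity>m\<in>{m \<in> A. m > n}. ennreal ((norm (W s (j + m - n) n) / norm (W t j m)) powr p))"
    using assms(1) by (intro infsum_cong) (simp add: weight_pow_def divide_ennreal powr_divide)
  then show ?thesis
    using assms(2) by (simp add: infsum_ennreal_le_iff cross_sum_def)
qed

definition orbit :: "(nat \<Rightarrow> 'a) \<Rightarrow> nat \<Rightarrow> nat \<Rightarrow> nat \<Rightarrow> 'a" where
  "orbit x s n = (backward_shift (w s) ^^ n) x"

lemma orbit_coord:
  assumes "x \<in> lp_space p" "1 \<le> i"
  shows "orbit x s n i = W s i n * x (i + n)"
  using assms backward_shift_funpow[where x=x and w="w s" and n=n and j=i] by (auto simp: orbit_def lp_space_def)

lemma orbit_in_lp_space: "x \<in> lp_space p \<Longrightarrow> s \<in> {1..N} \<Longrightarrow> orbit x s n \<in> lp_space p"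
  unfolding orbit_def by (intro backward_shift_funpow_lp p1 bounded_weights)

text \<open>
  Moving on from time \<open>n\<close> to time \<open>m\<close> multiplies by \<open>W s i (m - n)\<close> a coordinate of the orbit at
  time \<open>n\<close>. All the estimates for pairs of return times rest on this.
\<close>
lemma orbit_step:
  assumes "x \<in> lp_space p" "1 \<le> i" "n \<le> m"
  shows "orbit x s m i = W s i (m - n) * orbit x s n (i + m - n)"
  using assms weight_prod_split[of i n m s] by (simp add: orbit_coord)

text \<open>
  The first three clauses of the criterion, with finite real sums in place of infinite extended
  ones.
\<close>
definition separating :: "(nat \<Rightarrow> nat set) \<Rightarrow> (nat \<Rightarrow> real) \<Rightarrow> bool" where
  "separating A \<epsilon> \<longleftrightarrow>
    (\<forall>s\<in>{1..N}. (\<forall>n. W s 1 n \<noteq> 0) \<and> summable (\<lambda>n. 1 / norm (W s 1 n) powr p)) \<and>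
    (\<forall>j l k. 1 \<le> j \<and> j \<le> l \<and> 1 \<le> k \<longrightarrow>
      (\<forall>n\<in>A k. \<forall>s\<in>{1..N}. \<forall>t\<in>{1..N}. s \<noteq> t \<longrightarrow>
        (\<forall>F. finite F \<longrightarrow> F \<subseteq> {m \<in> A l. m > n} \<longrightarrow> cross_sum s t j n F \<le> \<epsilon> l))) \<and>
    (\<forall>j k l. 1 \<le> j \<and> j \<le> k \<and> k < l \<longrightarrow>
      (\<forall>n\<in>A l. \<forall>s\<in>{1..N}. \<forall>t\<in>{1..N}. s \<noteq> t \<longrightarrow>
        (\<forall>F. finite F \<longrightarrow> F \<subseteq> {m \<in> A k. m > n} \<longrightarrow> cross_sum s t j n F \<le> \<epsilon> l)))"

text \<open>
  The last clause of the criterion.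
\<close>
definition ratios_dense :: "(nat \<Rightarrow> nat set) \<Rightarrow> bool" where
  "ratios_dense A \<longleftrightarrow>
      (\<forall>l\<ge>1. \<forall>a :: nat \<Rightarrow> nat \<Rightarrow> 'a. (\<forall>s\<in>{1..N}. \<forall>j\<in>{1..l}. a s j \<noteq> 0) \<longrightarrow>
        (\<forall>\<delta>>0. \<exists>L\<ge>l. \<forall>s\<in>{1..N}. \<forall>t\<in>{1..N}. s \<noteq> t \<longrightarrow> (\<forall>n\<in>A L. \<forall>j\<in>{1..l}.
          norm (W s j n / W t j n - a s j / a t j) < \<delta>)))"

lemma separating_iff:
  assumes "\<forall>k\<ge>1. \<epsilon> k > 0"
  shows "separating A \<epsilon> \<longleftrightarrow>
      (\<forall>s\<in>{1..N}. (\<Sum>\<^sub>\<infinity>n\<in>{1..}. 1 / weight_pow p (w s) 1 n) < \<infinity>) \<and>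
      (\<forall>j l k. 1 \<le> j \<and> j \<le> l \<and> 1 \<le> k \<longrightarrow>
        (\<forall>n\<in>A k. \<forall>s\<in>{1..N}. \<forall>t\<in>{1..N}. s \<noteq> t \<longrightarrow>
          (\<Sum>\<^sub>\<infinity>m\<in>{m \<in> A l. m > n}. weight_pow p (w s) (j + m - n) n / weight_pow p (w t) j m)
            \<le> ennreal (\<epsilon> l))) \<and>
      (\<forall>j k l. 1 \<le> j \<and> j \<le> k \<and> k < l \<longrightarrow>
        (\<forall>n\<in>A l. \<forall>s\<in>{1..N}. \<forall>t\<in>{1..N}. s \<noteq> t \<longrightarrow>
          (\<Sum>\<^sub>\<infinity>m\<in>{m \<in> A k. m > n}. weight_pow p (w s) (j + m - n) n / weight_pow p (w t) j m)
            \<le> ennreal (\<epsilon> l)))"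
proof -
  have iff: "(\<Sum>\<^sub>\<infinity>m\<in>{m \<in> B. m > n}. weight_pow p (w s) (j + m - n) n / weight_pow p (w t) j m)
       \<le> ennreal (\<epsilon> l)
     \<longleftrightarrow> (\<forall>F. finite F \<longrightarrow> F \<subseteq> {m \<in> B. m > n} \<longrightarrow> cross_sum s t j n F \<le> \<epsilon> l)"
    if "\<forall>s\<in>{1..N}. \<forall>n. W s 1 n \<noteq> 0" "t \<in> {1..N}" "1 \<le> j" "1 \<le> l" for s t j n l B
    using that assms by (intro cross_sum_le_iff) (auto simp: weight_prod_nonzero less_imp_le)
  show ?thesis
    unfolding separating_def inverse_weights_summable_iff
  proof (intro conj_cong refl, goal_cases)
    case 1
    then have nz: "\<forall>s\<in>{1..N}. \<forall>n. W s 1 n \<noteq> 0" by blast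
    show ?case
      using iff[OF nz] by (intro iff_allI imp_cong ball_cong refl) auto
  next
    case 2
    then have nz: "\<forall>s\<in>{1..N}. \<forall>n. W s 1 n \<noteq> 0" by blast
    show ?case
      using iff[OF nz] by (intro iff_allI imp_cong ball_cong refl) auto
  qed
qed

section \<open>Necessity of the criterion\<close>

text \<open>
  If \<open>n < m\<close> are both return times, then \<open>W s 1 (m - n)\<close> carries the coordinate \<open>1 + m - n\<close> of the
  orbit at time \<open>n\<close> to the first coordinate at time \<open>m\<close>, which is at least \<open>c\<close>. So that coordinate
  is at least \<open>c / |W s 1 (m - n)|\<close>, and the norm of the orbit at time \<open>n\<close> bounds the sum over
  \<open>m\<close>.
\<close>
lemma inverse_weights_summable_if_returning:
  assumes s: "s \<in> {1..N}" and x: "x \<in> lp_space p" and A: "A \<in> family_uBd" and c: "c > 0"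
    and ret: "\<And>n. n \<in> A \<Longrightarrow> norm (orbit x s n 1) \<ge> c \<and> lp_norm p (orbit x s n) \<le> M"
  shows "(\<forall>n. W s 1 n \<noteq> 0) \<and> summable (\<lambda>n. 1 / norm (W s 1 n) powr p)"
proof
  have nz: "W s 1 n \<noteq> 0" for n
  proof -
    obtain m where "m \<in> A" "m \<ge> n"
      using infinite_if_uBd[OF A] by (metis infinite_nat_iff_unbounded_le)
    then have "W s 1 m \<noteq> 0"
      using ret[of m] c x by (auto simp: orbit_coord)
    then show ?thesis
      using weight_prod_split[of 1 "m - n" m s] \<open>m \<ge> n\<close> by auto
  qed
  then show "\<forall>n. W s 1 n \<noteq> 0" by blast
  obtain C where C: "C \<ge> 1" "\<forall>s\<in>{1..N}. \<forall>j n. norm (W s j n) \<le> C ^ n"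
    using weight_prod_growth by blast
  let ?\<alpha> = "\<lambda>k. 1 / norm (W s 1 k) powr p"
  show "summable ?\<alpha>"
  proof (rule summable_if_summable_over_differences[OF A, where C="C powr p" and B="(M / c) powr p"])
    show "?\<alpha> k \<le> C powr p * ?\<alpha> (Suc k)" for k
    proof -
      have "W s 1 (Suc k) = W s 1 k * W s (1 + k) 1"
        using weight_prod_add[of "w s" 1 k 1] by simp
      moreover have "norm (W s (1 + k) 1) powr p \<le> C powr p"
        using C(2)[rule_format, OF s, of "1 + k" 1] p1 by (intro powr_mono2) auto
      ultimately show ?thesis
        using nz[of k] nz[of "Suc k"] C(1) by (simp add: norm_mult powr_mult field_simps)
    qed
    show "C powr p \<ge> 1"
      using C(1) p1 by (simp add: ge_one_powr_ge_zero)
    fix n F assume n: "n \<in> A" and F: "finite F" "F \<subseteq> {m \<in> A. n < m}"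
    have le: "c powr p * ?\<alpha> (m - n) \<le> norm (orbit x s n (1 + m - n)) powr p" if "m \<in> F" for m
    proof -
      have m: "m \<in> A" "n < m"
        using that F by auto
      have "c \<le> norm (W s 1 (m - n)) * norm (orbit x s n (1 + m - n))"
        using ret[OF m(1)] orbit_step[OF x, of 1 n m s] m(2) by (simp add: norm_mult)
      then have "c powr p \<le> (norm (W s 1 (m - n)) * norm (orbit x s n (1 + m - n))) powr p"
        using c p1 by (intro powr_mono2) auto
      then show ?thesis
        using nz[of "m - n"] by (simp add: powr_mult field_simps)
    qed
    have "c powr p * (\<Sum>m\<in>F. ?\<alpha> (m - n)) \<le> (\<Sum>m\<in>F. norm (orbit x s n (1 + m - n)) powr p)"
      unfolding sum_distrib_left by (intro sum_mono le)
    also have "\<dots> = (\<Sum>i\<in>(\<lambda>m. 1 + m - n) ` F. norm (orbit x s n i) powr p)"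
    proof (subst sum.reindex)
      show "inj_on (\<lambda>m. 1 + m - n) F"
        by (rule inj_onI) (use F in force)
    qed simp
    also have "\<dots> \<le> lp_norm p (orbit x s n) powr p"
      using F by (intro lp_sum_le p1 orbit_in_lp_space x s) auto
    also have "\<dots> \<le> M powr p"
      using ret[OF n] p1 lp_norm_nonneg by (intro powr_mono2) auto
    finally show "(\<Sum>m\<in>F. ?\<alpha> (m - n)) \<le> (M / c) powr p"
    proof -
      assume "c powr p * (\<Sum>m\<in>F. ?\<alpha> (m - n)) \<le> M powr p"
      moreover have "M \<ge> 0"
        using ret[OF n] lp_norm_nonneg[of p "orbit x s n"] by linarith
      ultimately show ?thesis
        using c by (simp add: powr_divide field_simps)
    qed
  qed (use nz in auto)
qed

definition hits :: "(nat \<Rightarrow> 'a) \<Rightarrow> (nat \<Rightarrow> nat \<Rightarrow> 'a) \<Rightarrow> real \<Rightarrow> nat set" where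
  "hits x y \<delta> = {n. 1 \<le> n \<and> (\<forall>s\<in>{1..N}. lp_norm p (\<lambda>i. orbit x s n i - y s i) < \<delta>)}"

lemma hits_in_family:
  assumes x: "x \<in> lp_space p"
    and hyp: "\<forall>V. (\<forall>s\<in>{1..N}. openin (lp_topology p) (V s) \<and> V s \<noteq> {}) \<longrightarrow>
        {n. 1 \<le> n \<and> (\<forall>s\<in>{1..N}. (backward_shift (w s) ^^ n) x \<in> V s)} \<in> \<A>"
    and y: "\<And>s. s \<in> {1..N} \<Longrightarrow> y s \<in> lp_space p" and \<delta>: "\<delta> > 0"
  shows "hits x y \<delta> \<in> \<A>"
proof -
  interpret Metric_space "lp_space p :: (nat \<Rightarrow> 'a) set" "lp_dist p"
    by (rule Metric_space_lp[OF p1])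
  let ?V = "\<lambda>s. mball (y s) \<delta>"
  have "{n. 1 \<le> n \<and> (\<forall>s\<in>{1..N}. (backward_shift (w s) ^^ n) x \<in> ?V s)} \<in> \<A>"
    using y \<delta> by (intro hyp[rule_format]) (auto simp: lp_topology_def)
  also have "{n. 1 \<le> n \<and> (\<forall>s\<in>{1..N}. (backward_shift (w s) ^^ n) x \<in> ?V s)} = hits x y \<delta>"
    unfolding hits_def using y orbit_in_lp_space[OF x]
    by (auto simp: in_mball orbit_def[symmetric] commute[of "y _"]) (auto simp: lp_dist_def)
  finally show ?thesis .
qed

lemma hits_coord:
  assumes "x \<in> lp_space p" "y s \<in> lp_space p" "n \<in> hits x y \<delta>" "s \<in> {1..N}"
  shows "norm (orbit x s n i - y s i) < \<delta>"
proof -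
  have "(\<lambda>i. orbit x s n i - y s i) \<in> lp_space p"
    using assms by (intro lp_diff p1 orbit_in_lp_space)
  then show ?thesis
    using lp_coord_le[OF p1, of "\<lambda>i. orbit x s n i - y s i" i] assms(3,4)
    by (force simp: hits_def)
qed

text \<open>
  Outside the support of the target the orbit is part of the error.
\<close>
lemma hits_off_support:
  assumes "x \<in> lp_space p" "y s \<in> lp_space p" "n \<in> hits x y \<delta>" "s \<in> {1..N}"
    and F: "finite F" "\<And>i. i \<in> F \<Longrightarrow> y s i = 0"
  shows "(\<Sum>i\<in>F. norm (orbit x s n i) powr p) \<le> \<delta> powr p"
proof -
  let ?d = "\<lambda>i. orbit x s n i - y s i"
  have "(\<Sum>i\<in>F. norm (orbit x s n i) powr p) = (\<Sum>i\<in>F. norm (?d i) powr p)"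
    using F by simp
  also have "\<dots> \<le> lp_norm p ?d powr p"
    using assms by (intro lp_sum_le p1 lp_diff orbit_in_lp_space)
  also have "\<dots> \<le> \<delta> powr p"
    using assms(3,4) p1 by (intro powr_mono2 lp_norm_nonneg) (auto simp: hits_def less_imp_le)
  finally show ?thesis .
qed

lemma hits_norm_le:
  assumes "x \<in> lp_space p" "y s \<in> lp_space p" "n \<in> hits x y \<delta>" "s \<in> {1..N}"
  shows "lp_norm p (orbit x s n) \<le> lp_norm p (y s) + \<delta>"
proof -
  have "lp_norm p (\<lambda>i. (orbit x s n i - y s i) + y s i)
      \<le> lp_norm p (\<lambda>i. orbit x s n i - y s i) + lp_norm p (y s)"
    using assms by (intro lp_add p1 lp_diff orbit_in_lp_space)
  moreover have "lp_norm p (\<lambda>i. orbit x s n i - y s i) < \<delta>"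
    using assms(3,4) by (auto simp: hits_def)
  ultimately show ?thesis
    by simp
qed

text \<open>
  Both orbits contain the same coordinate \<open>x (j + m)\<close>, which cancels: a term of the cross sum is
  the quotient of the coordinate \<open>j + m - n\<close> of one orbit at time \<open>n\<close> and the coordinate \<open>j\<close> of
  the other at time \<open>m\<close>. The indices \<open>j + m - n\<close> are distinct for distinct \<open>m\<close>.
\<close>
lemma cross_sum_le:
  assumes x: "x \<in> lp_space p" and j: "1 \<le> j" and F: "finite F" "\<And>m. m \<in> F \<Longrightarrow> n < m" and P: "P > 0"
    and t: "\<And>m. m \<in> F \<Longrightarrow> norm (orbit x t m j) \<ge> P"
  shows "cross_sum s t j n F \<le> (1 / P) powr p * (\<Sum>i\<in>(\<lambda>m. j + m - n) ` F. norm (orbit x s n i) powr p)"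
proof -
  have "(norm (W s (j + m - n) n) / norm (W t j m)) powr p
      \<le> (1 / P) powr p * norm (orbit x s n (j + m - n)) powr p" if m: "m \<in> F" for m
  proof -
    have n: "n < m" using F(2)[OF m] .
    have eq: "norm (orbit x s n (j + m - n)) = norm (W s (j + m - n) n) * norm (x (j + m))"
      "norm (orbit x t m j) = norm (W t j m) * norm (x (j + m))"
      using x j n by (auto simp: orbit_coord norm_mult)
    have nz: "norm (W t j m) > 0" "norm (x (j + m)) > 0"
      using t[OF m] P eq(2) by auto
    have "norm (W s (j + m - n) n) / norm (W t j m)
        = norm (orbit x s n (j + m - n)) / norm (orbit x t m j)"
      unfolding eq using nz by simp
    also have "\<dots> \<le> norm (orbit x s n (j + m - n)) / P"
      using t[OF m] P by (intro divide_left_mono mult_pos_pos) auto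
    finally have "(norm (W s (j + m - n) n) / norm (W t j m)) powr p
        \<le> (1 / P * norm (orbit x s n (j + m - n))) powr p"
      using p1 by (intro powr_mono2) auto
    then show ?thesis
      using P by (simp add: powr_mult powr_divide)
  qed
  then have "cross_sum s t j n F \<le> (\<Sum>m\<in>F. (1 / P) powr p * norm (orbit x s n (j + m - n)) powr p)"
    unfolding cross_sum_def by (intro sum_mono)
  also have "\<dots> = (1 / P) powr p * (\<Sum>i\<in>(\<lambda>m. j + m - n) ` F. norm (orbit x s n i) powr p)"
  proof (subst sum.reindex)
    show "inj_on (\<lambda>m. j + m - n) F"
      by (rule inj_onI) (use F(2) in force)
  qed (simp add: sum_distrib_left)
  finally show ?thesis .
qed

text \<open>
  The targets are \<open>R k\<close> times the given tuples, cut off at \<open>k\<close>. Here \<open>P k\<close> bounds the nonzero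
  coordinates of the \<open>k\<close>-th targets from below, and \<open>E k\<close> bounds the norms of all vectors at
  distance at most \<open>1\<close> from them. Since \<open>R k\<close> is chosen after \<open>R l\<close> for \<open>l < k\<close>, the number \<open>P k\<close>
  can dominate all earlier \<open>E l\<close>, even after at most \<open>k\<close> steps of the shifts; the tolerance \<open>\<delta> k\<close>
  is chosen last, so small that neither \<open>k\<close> further steps nor the formation of quotients makes the
  error visible.
\<close>
lemma separated_targets:
  fixes b :: "nat \<Rightarrow> nat \<Rightarrow> nat \<Rightarrow> 'a"
  assumes nz: "\<forall>s\<in>{1..N}. \<forall>n. W s 1 n \<noteq> 0" and b: "\<And>k s j. b k s j \<noteq> 0"
  shows "\<exists>y P E \<delta>. \<forall>k.
    (\<forall>s\<in>{1..N}. y k s \<in> lp_space p \<and> (\<forall>j. j \<notin> {1..k} \<longrightarrow> y k s j = 0) \<and>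
       (\<forall>j\<in>{1..k}. P k \<le> norm (y k s j)) \<and> lp_norm p (y k s) + 1 \<le> E k) \<and>
    2 \<le> P k \<and> 0 < \<delta> k \<and> \<delta> k \<le> 1 / (real k + 1) \<and> C ^ k * \<delta> k \<le> 1 / 2 \<and>
    (\<forall>l<k. 2 * real k * E l \<le> P k \<and> (\<forall>s\<in>{1..N}. \<forall>q\<le>k. 2 * E l < norm (W s 1 q) * P k)) \<and>
    (\<forall>s\<in>{1..N}. \<forall>t\<in>{1..N}. \<forall>j\<in>{1..k}. \<forall>u v.
       norm (u - y k s j) < \<delta> k \<longrightarrow> norm (v - y k t j) < \<delta> k \<longrightarrow>
       norm (u / v - b k s j / b k t j) < 1 / (real k + 1))"
proof -
  have "\<forall>k. \<exists>c>0. c \<le> 1 \<and> (\<forall>z\<in>{1..N} \<times> {1..k}. c \<le> norm (b k (fst z) (snd z)))"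
    using b by (intro allI finite_positive_lower_bound) auto
  then obtain c where c':
    "\<forall>k. c k > 0 \<and> c k \<le> 1 \<and> (\<forall>z\<in>{1..N} \<times> {1..k}. c k \<le> norm (b k (fst z) (snd z)))"
    by (rule choice[THEN exE])
  have c: "c k > 0" "s \<in> {1..N} \<Longrightarrow> j \<in> {1..k} \<Longrightarrow> c k \<le> norm (b k s j)" for k s j
    using c'[rule_format, of k] by auto
  have "\<forall>k. \<exists>\<omega>>0. \<omega> \<le> 1 \<and> (\<forall>z\<in>{1..N} \<times> {..k}. \<omega> \<le> norm (W (fst z) 1 (snd z)))"
    using nz by (intro allI finite_positive_lower_bound) auto
  then obtain \<omega> where \<omega>':
    "\<forall>k. \<omega> k > 0 \<and> \<omega> k \<le> 1 \<and> (\<forall>z\<in>{1..N} \<times> {..k}. \<omega> k \<le> norm (W (fst z) 1 (snd z)))"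
    by (rule choice[THEN exE])
  have \<omega>: "\<omega> k > 0" "\<omega> k \<le> 1" "s \<in> {1..N} \<Longrightarrow> q \<le> k \<Longrightarrow> \<omega> k \<le> norm (W s 1 q)" for k s q
    using \<omega>'[rule_format, of k] by auto
  \<comment> \<open>Cut-off tuples before scaling; \<open>S k\<close> bounds their norms.\<close>
  define z where "z k s = (\<lambda>j. if j \<in> {1..k} then b k s j else 0)" for k s
  have z: "z k s \<in> lp_space p" for k s
    by (rule finite_support_in_lp_space) (auto simp: z_def intro: finite_subset[of _ "{1..k}"])
  define S where "S k = (\<Sum>s\<in>{1..N}. lp_norm p (z k s))" for k
  have S: "lp_norm p (z k s) \<le> S k" if "s \<in> {1..N}" for k s
    unfolding S_def using that by (intro member_le_sum) (auto simp: lp_norm_nonneg)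
  have S0: "S k \<ge> 0" for k
    unfolding S_def by (intro sum_nonneg lp_norm_nonneg)
  obtain R where R: "\<And>k. R k \<ge> 2 / c k"
    "\<And>k l. l < k \<Longrightarrow> R k \<ge> 2 * (real k + 1) * (R l * S l + 2) / (c k * \<omega> k)"
    using fast_growing_sequence[of "\<lambda>k. 2 / c k" "\<lambda>k l r. 2 * (real k + 1) * (r * S l + 2) / (c k * \<omega> k)"]
    by blast
  have R0: "R k > 0" for k
    using R(1)[of k] c(1)[of k] by (smt (verit) divide_pos_pos)
  define P where "P k = R k * c k" for k
  define E where "E k = R k * S k + 1" for k
  define y where "y k s = (\<lambda>j. of_real (R k) * z k s j)" for k s
  have E1: "E k \<ge> 1" for k
    using R0[of k] S0[of k] by (simp add: E_def)
  have P2: "2 \<le> P k" for k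
    using R(1)[of k] c(1)[of k] by (simp add: P_def field_simps)
  have P\<omega>: "2 * (real k + 1) * (E l + 1) \<le> \<omega> k * P k" if "l < k" for k l
    using R(2)[OF that] c(1)[of k] \<omega>(1)[of k] by (simp add: P_def E_def field_simps)
  have y_supp: "y k s \<in> lp_space p" "\<And>j. j \<notin> {1..k} \<Longrightarrow> y k s j = 0" for k s
    by (auto simp: y_def z_def intro!: finite_support_in_lp_space finite_subset[of _ "{1..k}"]
        split: if_splits)
  have y_low: "P k \<le> norm (y k s j)" if "s \<in> {1..N}" "j \<in> {1..k}" for k s j
    using c(2)[OF that] that R0[of k] by (simp add: y_def z_def P_def norm_mult)
  have y_norm: "lp_norm p (y k s) + 1 \<le> E k" if "s \<in> {1..N}" for k s
    using S[OF that, of k] R0[of k] by (simp add: y_def E_def lp_norm_scale[OF p1 z])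
  have y_nz: "y k s j \<noteq> 0" if "s \<in> {1..N}" "j \<in> {1..k}" for k s j
    using y_low[OF that] P2[of k] by auto
  have sep: "2 * real k * E l \<le> P k \<and> (\<forall>s\<in>{1..N}. \<forall>q\<le>k. 2 * E l < norm (W s 1 q) * P k)" if "l < k" for k l
  proof
    have "\<omega> k * P k \<le> 1 * P k"
      using \<omega>(2)[of k] P2[of k] by (intro mult_right_mono) auto
    moreover have "2 * real k * E l \<le> 2 * (real k + 1) * (E l + 1)"
      using E1[of l] by (intro mult_mono) auto
    ultimately show "2 * real k * E l \<le> P k"
      using P\<omega>[OF that] by linarith
    show "\<forall>s\<in>{1..N}. \<forall>q\<le>k. 2 * E l < norm (W s 1 q) * P k"
    proof (intro ballI allI impI)
      fix s q assume "s \<in> {1..N}" "q \<le> k"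
      then have le: "\<omega> k * P k \<le> norm (W s 1 q) * P k"
        using \<omega>(3) P2[of k] by (intro mult_right_mono) auto
      have "2 * E l < 2 * (E l + 1)"
        by simp
      also have "\<dots> \<le> (2 * (real k + 1)) * (E l + 1)"
        using E1[of l] by (intro mult_right_mono) auto
      also have "\<dots> \<le> \<omega> k * P k"
        using P\<omega>[OF that] by simp
      also note le
      finally show "2 * E l < norm (W s 1 q) * P k" .
    qed
  qed
  have "\<exists>d>0. d \<le> 1 / (real k + 1) \<and> C ^ k * d \<le> 1 / 2 \<and>
    (\<forall>s\<in>{1..N}. \<forall>t\<in>{1..N}. \<forall>j\<in>{1..k}. \<forall>u v.
       norm (u - y k s j) < d \<longrightarrow> norm (v - y k t j) < d \<longrightarrow>
       norm (u / v - b k s j / b k t j) < 1 / (real k + 1))" for k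
  proof -
    have "\<forall>\<^sub>F d in at_right 0. \<forall>u v.
       norm (u - y k s j) < d \<longrightarrow> norm (v - y k t j) < d \<longrightarrow>
       norm (u / v - b k s j / b k t j) < 1 / (real k + 1)"
      if "s \<in> {1..N}" "t \<in> {1..N}" "j \<in> {1..k}" for s t j
    proof -
      have "y k s j / y k t j = b k s j / b k t j"
        using that R0[of k] by (simp add: y_def z_def)
      then show ?thesis
        using eventually_quotient_close[OF y_nz, of t j k "1 / (real k + 1)" "y k s j"] that by simp
    qed
    then have "\<forall>\<^sub>F d in at_right 0. \<forall>s\<in>{1..N}. \<forall>t\<in>{1..N}. \<forall>j\<in>{1..k}. \<forall>u v.
       norm (u - y k s j) < d \<longrightarrow> norm (v - y k t j) < d \<longrightarrow>
       norm (u / v - b k s j / b k t j) < 1 / (real k + 1)"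
      by (intro eventually_ball_finite ballI) auto
    moreover have "\<forall>\<^sub>F d in at_right 0. C ^ k * d < 1 / 2"
    proof (rule order_tendstoD(2))
      show "((\<lambda>d. C ^ k * d) \<longlongrightarrow> C ^ k * 0) (at_right 0)"
        by (intro tendsto_intros)
    qed auto
    moreover have "\<forall>\<^sub>F d in at_right 0. d < 1 / (real k + 1)"
      by (intro order_tendstoD(2)[OF tendsto_ident_at]) auto
    moreover have "\<forall>\<^sub>F d in at_right 0. (0::real) < d"
      by (rule eventually_at_right_less)
    ultimately have "\<forall>\<^sub>F d in at_right 0. d > 0 \<and> d \<le> 1 / (real k + 1) \<and> C ^ k * d \<le> 1 / 2 \<and>
    (\<forall>s\<in>{1..N}. \<forall>t\<in>{1..N}. \<forall>j\<in>{1..k}. \<forall>u v.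
       norm (u - y k s j) < d \<longrightarrow> norm (v - y k t j) < d \<longrightarrow>
       norm (u / v - b k s j / b k t j) < 1 / (real k + 1))"
      by eventually_elim auto
    then show ?thesis
      using eventually_happens' trivial_limit_at_right_real by blast
  qed
  then obtain \<delta> where \<delta>: "\<forall>k. \<delta> k > 0 \<and> \<delta> k \<le> 1 / (real k + 1) \<and> C ^ k * \<delta> k \<le> 1 / 2 \<and>
    (\<forall>s\<in>{1..N}. \<forall>t\<in>{1..N}. \<forall>j\<in>{1..k}. \<forall>u v.
       norm (u - y k s j) < \<delta> k \<longrightarrow> norm (v - y k t j) < \<delta> k \<longrightarrow>
       norm (u / v - b k s j / b k t j) < 1 / (real k + 1))"
    by (rule choice[OF allI, THEN exE])
  show ?thesis
    by (rule exI[of _ y], rule exI[of _ P], rule exI[of _ E], rule exI[of _ \<delta>])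
      (use \<delta> sep P2 y_supp y_low y_norm in auto)
qed

text \<open>
  The sets \<open>A k\<close> are the times at which the orbits are near the \<open>k\<close>-th target, and \<open>\<epsilon> l = 1 / l\<close>:
  cross sums are at most \<open>\<delta> k powr p \<le> 1 / (k + 1)\<close> for a time in \<open>A k\<close> and \<open>l \<le> k\<close>, and at most
  \<open>(1 / l) powr p\<close> for \<open>k < l\<close>.
\<close>
lemma disjoint_hypercyclic_imp_separating:
  assumes fam: "\<A> \<in> {family_uBd, family_ud, family_ld}" and x: "x \<in> lp_space p"
    and hyp: "\<forall>V. (\<forall>s\<in>{1..N}. openin (lp_topology p) (V s) \<and> V s \<noteq> {}) \<longrightarrow>
        {n. 1 \<le> n \<and> (\<forall>s\<in>{1..N}. (backward_shift (w s) ^^ n) x \<in> V s)} \<in> \<A>"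
  shows "\<exists>A \<epsilon>. (\<forall>k\<ge>1. A k \<in> \<A>) \<and> disjoint_family_on A {1..} \<and>
      (\<forall>k\<ge>1. \<epsilon> k > 0) \<and> \<epsilon> \<longlonglongrightarrow> 0 \<and> separating A \<epsilon> \<and> ratios_dense A"
proof -
  have summable: "(\<forall>n. W s 1 n \<noteq> 0) \<and> summable (\<lambda>n. 1 / norm (W s 1 n) powr p)" if s: "s \<in> {1..N}" for s
  proof -
    have u: "unit_seq 1 \<in> (lp_space p :: (nat \<Rightarrow> 'a) set)"
      by (rule finite_support_in_lp_space) (auto simp: unit_seq_def)
    let ?A = "hits x (\<lambda>_. unit_seq 1) (1 / 2)"
    have "?A \<in> \<A>"
      using u by (intro hits_in_family[OF x hyp]) auto
    then have A: "?A \<in> family_uBd"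
      using density_family_subset_uBd[OF fam] by blast
    have "norm (orbit x s n 1) \<ge> 1 / 2 \<and> lp_norm p (orbit x s n) \<le> lp_norm p (unit_seq 1 :: nat \<Rightarrow> 'a) + 1 / 2"
      if n: "n \<in> ?A" for n
    proof
      have "norm (orbit x s n 1 - 1) < 1 / 2"
        using hits_coord[where y="\<lambda>_. unit_seq 1", OF x u n s, of 1] by (simp add: unit_seq_def)
      then show "norm (orbit x s n 1) \<ge> 1 / 2"
        using norm_triangle_ineq2[of 1 "orbit x s n 1"] by (simp add: norm_minus_commute)
      show "lp_norm p (orbit x s n) \<le> lp_norm p (unit_seq 1 :: nat \<Rightarrow> 'a) + 1 / 2"
        using hits_norm_le[where y="\<lambda>_. unit_seq 1", OF x u n s] .
    qed
    then show ?thesis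
      by (intro inverse_weights_summable_if_returning[OF s x A, of "1 / 2"]) auto
  qed
  then have nz: "\<forall>s\<in>{1..N}. \<forall>n. W s 1 n \<noteq> 0"
    by blast
  obtain C where C: "C \<ge> 1" "\<forall>s\<in>{1..N}. \<forall>j n. norm (W s j n) \<le> C ^ n"
    using weight_prod_growth by blast
  obtain b :: "nat \<Rightarrow> nat \<Rightarrow> nat \<Rightarrow> 'a" and len where b0: "\<forall>i s j. b i s j \<noteq> 0"
    and dense: "\<forall>l N a e K. e > 0 \<longrightarrow>
        (\<exists>i\<ge>K. len i = l \<and> (\<forall>s\<le>N. \<forall>j\<le>l. norm (b i s j - a s j) < e))"
    using nonzero_dense_tables[where 'a='a] by (elim exE conjE)
  obtain y :: "nat \<Rightarrow> nat \<Rightarrow> nat \<Rightarrow> 'a" and P E \<delta> where *: "\<forall>k.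
    (\<forall>s\<in>{1..N}. y k s \<in> lp_space p \<and> (\<forall>j. j \<notin> {1..k} \<longrightarrow> y k s j = 0) \<and>
       (\<forall>j\<in>{1..k}. P k \<le> norm (y k s j)) \<and> lp_norm p (y k s) + 1 \<le> E k) \<and>
    2 \<le> P k \<and> 0 < \<delta> k \<and> \<delta> k \<le> 1 / (real k + 1) \<and> C ^ k * \<delta> k \<le> 1 / 2 \<and>
    (\<forall>l<k. 2 * real k * E l \<le> P k \<and> (\<forall>s\<in>{1..N}. \<forall>q\<le>k. 2 * E l < norm (W s 1 q) * P k)) \<and>
    (\<forall>s\<in>{1..N}. \<forall>t\<in>{1..N}. \<forall>j\<in>{1..k}. \<forall>u v.
       norm (u - y k s j) < \<delta> k \<longrightarrow> norm (v - y k t j) < \<delta> k \<longrightarrow>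
       norm (u / v - b k s j / b k t j) < 1 / (real k + 1))"
    using separated_targets[where b=b and C=C, OF nz b0[rule_format]] by (elim exE)
  have y: "y k s \<in> lp_space p" and y_supp: "j \<notin> {1..k} \<Longrightarrow> y k s j = 0"
    and y_low: "j \<in> {1..k} \<Longrightarrow> P k \<le> norm (y k s j)" and y_norm: "lp_norm p (y k s) + 1 \<le> E k"
    if "s \<in> {1..N}" for k s j
    using *[rule_format, of k] that by blast+
  have P2: "2 \<le> P k" and \<delta>0: "0 < \<delta> k" and \<delta>k: "\<delta> k \<le> 1 / (real k + 1)" and \<delta>C: "C ^ k * \<delta> k \<le> 1 / 2" for k
    using *[rule_format, of k] by blast+
  have PE: "2 * real k * E l \<le> P k" and PW: "s \<in> {1..N} \<Longrightarrow> q \<le> k \<Longrightarrow> 2 * E l < norm (W s 1 q) * P k"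
    if "l < k" for k l s q
    using *[rule_format, of k] that by blast+
  have ratio: "norm (u / v - b k s j / b k t j) < 1 / (real k + 1)"
    if "s \<in> {1..N}" "t \<in> {1..N}" "j \<in> {1..k}" "norm (u - y k s j) < \<delta> k" "norm (v - y k t j) < \<delta> k"
    for k s t j u v
    using *[rule_format, of k] that by blast
  have \<delta>1: "\<delta> k \<le> 1" for k
    using \<delta>k[of k] by (rule order_trans) simp
  have \<delta>2: "\<delta> k \<le> 1 / 2" if "k \<ge> 1" for k
    using \<delta>k[of k] by (rule order_trans) (use that in \<open>simp add: field_simps\<close>)

  define A where "A k = hits x (y k) (\<delta> k)" for k
  have A: "A k \<in> \<A>" for k
    unfolding A_def using y \<delta>0 by (intro hits_in_family[OF x hyp]) auto
  have close: "norm (orbit x s n i - y k s i) < \<delta> k" if "n \<in> A k" "s \<in> {1..N}" for n k s i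
    using that unfolding A_def by (intro hits_coord x y)
  have normE: "lp_norm p (orbit x s n) \<le> E k" if "n \<in> A k" "s \<in> {1..N}" for n k s
    using hits_norm_le[where y="y k" and s=s and n=n and \<delta>="\<delta> k", OF x y[OF that(2)]] that y_norm[OF that(2), of k] \<delta>1[of k]
    by (auto simp: A_def)
  have coordE: "norm (orbit x s n i) \<le> E k" if "n \<in> A k" "s \<in> {1..N}" for n k s i
    using lp_coord_le[OF p1 orbit_in_lp_space[OF x that(2)]] normE[OF that] by (rule order_trans)
  have big: "P k / 2 \<le> norm (orbit x s n j)" if "n \<in> A k" "s \<in> {1..N}" "j \<in> {1..k}" for n k s j
  proof -
    have "P k \<le> norm (y k s j)"
      using y_low that by blast
    moreover have "norm (y k s j) - norm (orbit x s n j) \<le> norm (orbit x s n j - y k s j)"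
      by (metis norm_minus_commute norm_triangle_ineq2)
    ultimately show ?thesis
      using close[OF that(1,2), of j] P2[of k] \<delta>1[of k] by linarith
  qed
  have small: "norm (orbit x s n i) < \<delta> k" if "n \<in> A k" "s \<in> {1..N}" "i > k" for n k s i
    using close[OF that(1,2), of i] y_supp[OF that(2), of i k] that(3) by simp
  have gap: "k < m - n" if lk: "1 \<le> l" "l \<le> k" and n: "n \<in> A k" and m: "m \<in> A l" and "n < m" for k l m n
  proof (rule ccontr)
    define q where "q = m - n"
    assume "\<not> k < m - n"
    then have q: "1 \<le> q" "q \<le> k"
      using \<open>n < m\<close> by (auto simp: q_def)
    have s: "1 \<in> {1..N}"
      using N2 by simp
    have step: "norm (orbit x 1 m i) = norm (W 1 i q) * norm (orbit x 1 n (i + q))" if "1 \<le> i" for i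
      using orbit_step[OF x that, of n m 1] \<open>n < m\<close> by (simp add: q_def norm_mult)
    show False
    \<comment> \<open>A shift by \<open>q \<le> k\<close> steps moves coordinate \<open>l + q\<close> to place \<open>l\<close> and coordinate \<open>1 + q\<close>
      to place \<open>1\<close>. Either \<open>l + q\<close> is outside the support \<open>{1..k}\<close> and the result is too small, or
      \<open>1 + q\<close> is inside it and the result is too large for the \<open>l\<close>-th target.\<close>
    proof (cases "l + q > k")
      case True
      have "norm (W 1 l q) \<le> C ^ k"
        using C(2)[rule_format, OF s, of l q] power_increasing[OF q(2) C(1)] by linarith
      then have "norm (orbit x 1 m l) \<le> C ^ k * \<delta> k"
        unfolding step[OF lk(1)] using small[OF n s True] C(1) by (intro mult_mono) auto
      then have "norm (orbit x 1 m l) \<le> 1 / 2"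
        using \<delta>C[of k] by linarith
      then show False
        using big[OF m s, of l] lk(1) P2[of l] by simp
    next
      case False
      then have "l < k" "1 + q \<in> {1..k}"
        using q lk by auto
      have "norm (W 1 1 q) * (P k / 2) \<le> norm (W 1 1 q) * norm (orbit x 1 n (1 + q))"
        using big[OF n s \<open>1 + q \<in> {1..k}\<close>] by (intro mult_left_mono) auto
      also have "\<dots> \<le> E l"
        using coordE[OF m s, of 1] step[of 1] by simp
      finally show False
        using PW[OF \<open>l < k\<close> s q(2)] by simp
    qed
  qed
  have disj: "A k \<inter> A l = {}" if "1 \<le> l" "l < k" for k l
  proof (rule ccontr)
    assume "A k \<inter> A l \<noteq> {}"
    then obtain n where n: "n \<in> A k" "n \<in> A l"
      by blast
    have s: "1 \<in> {1..N}"
      using N2 by simp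
    have "P k / 2 \<le> E l"
      using big[OF n(1) s, of 1] coordE[OF n(2) s, of 1] that by auto
    then show False
      using PW[OF that(2) s, of 0] by simp
  qed

  define \<epsilon> where "\<epsilon> l = 1 / real l" for l
  have powr_le: "u powr p \<le> u" if "0 \<le> u" "u \<le> 1" for u :: real
    using powr_mono'[of 1 p u] p1 that by simp
  have cross: "cross_sum s t j n F \<le> (2 / P l) powr p * (\<Sum>i\<in>(\<lambda>m. j + m - n) ` F. norm (orbit x s n i) powr p)"
    if "j \<in> {1..l}" "t \<in> {1..N}" "finite F" "F \<subseteq> {m \<in> A l. n < m}" for s t j n l F
  proof -
    have "n < m \<and> P l / 2 \<le> norm (orbit x t m j)" if "m \<in> F" for m
      using big[of m l t j] that \<open>F \<subseteq> {m \<in> A l. n < m}\<close> \<open>j \<in> {1..l}\<close> \<open>t \<in> {1..N}\<close> by blast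
    then show ?thesis
      using cross_sum_le[OF x, of j F n "P l / 2" t s] that P2[of l] by auto
  qed
  \<comment> \<open>By the gaps, a sum over \<open>A l\<close> at a time of \<open>A k\<close> with \<open>l \<le> k\<close> sees the orbit beyond place
    \<open>k\<close> only.\<close>
  have far: "cross_sum s t j n F \<le> \<epsilon> r"
    if "j \<in> {1..l}" "l \<le> k" "1 \<le> r" "r \<le> k" "n \<in> A k" "s \<in> {1..N}" "t \<in> {1..N}" "finite F" "F \<subseteq> {m \<in> A l. n < m}"
    for s t j n k l F r
  proof -
    have "y k s i = 0" if i: "i \<in> (\<lambda>m. j + m - n) ` F" for i
    proof -
      obtain m where m: "i = j + m - n" "m \<in> F"
        using i by blast
      then have "k < m - n" "n < m"
        using gap[of l k n m] \<open>j \<in> {1..l}\<close> \<open>l \<le> k\<close> \<open>n \<in> A k\<close> \<open>F \<subseteq> {m \<in> A l. n < m}\<close> by auto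
      then show ?thesis
        using m(1) by (intro y_supp[OF \<open>s \<in> {1..N}\<close>]) auto
    qed
    then have "(\<Sum>i\<in>(\<lambda>m. j + m - n) ` F. norm (orbit x s n i) powr p) \<le> \<delta> k powr p"
      using that
      by (intro hits_off_support[where y="y k" and s=s, OF x y[OF \<open>s \<in> {1..N}\<close>]]) (auto simp: A_def)
    moreover have "(2 / P l) powr p \<le> 1"
      using P2[of l] p1 by (intro powr_le1) auto
    ultimately have "(2 / P l) powr p * (\<Sum>i\<in>(\<lambda>m. j + m - n) ` F. norm (orbit x s n i) powr p) \<le> 1 * \<delta> k powr p"
      by (intro mult_mono) (auto intro!: sum_nonneg)
    also have "\<dots> \<le> \<delta> k"
      using powr_le[of "\<delta> k"] \<delta>0[of k] \<delta>1[of k] by simp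
    also have "\<dots> \<le> 1 / (real k + 1)"
      by (rule \<delta>k)
    also have "\<dots> \<le> \<epsilon> r"
      using that(3,4) unfolding \<epsilon>_def by (intro divide_left_mono) auto
    finally show ?thesis
      using cross[OF that(1,7,8,9), of s] by linarith
  qed
  \<comment> \<open>For \<open>k < l\<close> the whole orbit may occur, but the denominators are at least \<open>P l / 2\<close>, hence
    at least \<open>l * E k\<close>.\<close>
  have near: "cross_sum s t j n F \<le> \<epsilon> l"
    if "j \<in> {1..l}" "k < l" "n \<in> A k" "s \<in> {1..N}" "t \<in> {1..N}" "finite F" "F \<subseteq> {m \<in> A l. n < m}"
    for s t j n k l F
  proof -
    have E0: "E k \<ge> 0"
      using coordE[OF that(3,4), of 0] norm_ge_zero order_trans by blast
    have "(\<Sum>i\<in>(\<lambda>m. j + m - n) ` F. norm (orbit x s n i) powr p) \<le> lp_norm p (orbit x s n) powr p"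
      using that by (intro lp_sum_le p1 orbit_in_lp_space x) auto
    also have "\<dots> \<le> E k powr p"
      using normE[OF that(3,4)] p1 by (intro powr_mono2 lp_norm_nonneg) auto
    finally have "(2 / P l) powr p * (\<Sum>i\<in>(\<lambda>m. j + m - n) ` F. norm (orbit x s n i) powr p)
        \<le> (2 / P l) powr p * E k powr p"
      by (intro mult_left_mono) auto
    also have "\<dots> = (2 * E k / P l) powr p"
      using P2[of l] E0 by (simp add: powr_divide powr_mult)
    also have "\<dots> \<le> (1 / real l) powr p"
      using PE[OF that(2)] P2[of l] E0 p1 that(2) by (intro powr_mono2) (auto simp: field_simps)
    also have "\<dots> \<le> \<epsilon> l"
      unfolding \<epsilon>_def using that(2) by (intro powr_le) auto
    finally show ?thesis
      using cross[OF that(1,5,6,7), of s] by linarith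
  qed
  have sepA: "separating A \<epsilon>"
    unfolding separating_def
  proof (intro conjI allI impI ballI, goal_cases)
    case (3 j l k n s t F)
    then show ?case
      using near[of j l k n s t F] far[of j l k l n s t F] by (cases "k < l") auto
  next
    case (4 j k l n s t F)
    then show ?case
      using far[of j k l l n s t F] by auto
  qed (use summable in auto)
  have disjA: "disjoint_family_on A {1..}"
    unfolding disjoint_family_on_def using disj by (metis atLeast_iff inf_commute linorder_neqE_nat)
  have lim: "\<epsilon> \<longlonglongrightarrow> 0"
    unfolding \<epsilon>_def by (rule lim_1_over_n)
  have approx: "\<exists>L\<ge>l. \<forall>s\<in>{1..N}. \<forall>t\<in>{1..N}. s \<noteq> t \<longrightarrow> (\<forall>n\<in>A L. \<forall>j\<in>{1..l}.
          norm (W s j n / W t j n - a s j / a t j) < e)"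
    if a: "\<forall>s\<in>{1..N}. \<forall>j\<in>{1..l}. a s j \<noteq> 0" and e: "e > 0" for l e and a :: "nat \<Rightarrow> nat \<Rightarrow> 'a"
  proof -
    have "\<forall>\<^sub>F d in at_right 0. \<forall>s\<in>{1..N}. \<forall>t\<in>{1..N}. \<forall>j\<in>{1..l}. \<forall>u v.
       norm (u - a s j) < d \<longrightarrow> norm (v - a t j) < d \<longrightarrow> norm (u / v - a s j / a t j) < e / 2"
      using a e by (intro eventually_ball_finite ballI eventually_quotient_close) auto
    then have "\<forall>\<^sub>F d in at_right 0. d > 0 \<and> (\<forall>s\<in>{1..N}. \<forall>t\<in>{1..N}. \<forall>j\<in>{1..l}. \<forall>u v.
       norm (u - a s j) < d \<longrightarrow> norm (v - a t j) < d \<longrightarrow> norm (u / v - a s j / a t j) < e / 2)"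
      by (intro eventually_conj eventually_at_right_less)
    then obtain d where d: "d > 0" "\<forall>s\<in>{1..N}. \<forall>t\<in>{1..N}. \<forall>j\<in>{1..l}. \<forall>u v.
       norm (u - a s j) < d \<longrightarrow> norm (v - a t j) < d \<longrightarrow> norm (u / v - a s j / a t j) < e / 2"
      using eventually_happens' trivial_limit_at_right_real by blast
    obtain K where K: "real K > 2 / e"
      using reals_Archimedean2 by blast
    obtain L where L: "L \<ge> max l K" "\<forall>s\<le>N. \<forall>j\<le>l. norm (b L s j - a s j) < d"
      using dense[rule_format, OF d(1), of "max l K" l N a] by blast
    have "2 / e < real L + 1"
      using K L(1) by simp
    then have Le: "1 / (real L + 1) < e / 2"
      using e by (simp add: field_simps)
    have "norm (W s j n / W t j n - a s j / a t j) < e"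
      if s: "s \<in> {1..N}" and t: "t \<in> {1..N}" and n: "n \<in> A L" and j: "j \<in> {1..l}" for s t n j
    proof -
      have jL: "j \<in> {1..L}" and j1: "1 \<le> j"
        using j L(1) by auto
      have "orbit x t n j \<noteq> 0"
        using big[OF n t jL] P2[of L] by auto
      then have "W s j n / W t j n = orbit x s n j / orbit x t n j"
        using x j1 by (auto simp: orbit_coord)
      then have "norm (W s j n / W t j n - b L s j / b L t j) < 1 / (real L + 1)"
        using ratio[OF s t jL close[OF n s] close[OF n t]] by simp
      moreover have "norm (b L s j / b L t j - a s j / a t j) < e / 2"
        using d(2) L(2) s t j by auto
      ultimately have "norm ((W s j n / W t j n - b L s j / b L t j) + (b L s j / b L t j - a s j / a t j)) < e"
        using Le norm_triangle_ineq[of "W s j n / W t j n - b L s j / b L t j" "b L s j / b L t j - a s j / a t j"]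
        by linarith
      then show ?thesis
        by simp
    qed
    then show ?thesis
      using L(1) by (intro exI[of _ L]) auto
  qed
  then have dense_ratios: "ratios_dense A"
    unfolding ratios_dense_def by blast
  have pos: "\<forall>k\<ge>1. \<epsilon> k > 0"
    by (simp add: \<epsilon>_def)
  show ?thesis
    by (rule exI[of _ A], rule exI[of _ \<epsilon>], intro conjI allI impI pos disjA lim sepA dense_ratios A)
qed

end

section \<open>Vectors assembled from disjoint blocks\<close>

text \<open>
  The index \<open>q\<close>, translated by \<open>n\<close>, lies in the block that starts after \<open>m \<in> B i\<close>; it determines
  at least one triple \<open>(i, m, j)\<close>, and different \<open>q\<close> give different triples. So the sum over \<open>q\<close>
  is at most a sum over triples, which can be arranged by \<open>i\<close>.
\<close>
lemma sum_over_blocks_le: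
  fixes \<phi> :: "nat \<Rightarrow> real" and f :: "nat \<Rightarrow> nat \<Rightarrow> nat \<Rightarrow> real"
  assumes Q: "finite Q"
    and pos: "\<And>q. q \<in> Q \<Longrightarrow> \<phi> q \<noteq> 0 \<Longrightarrow>
      \<exists>i m j. m \<in> B i \<and> j \<in> {1..len i} \<and> q + n = j + m \<and> \<phi> q \<le> f i m j"
    and f0: "\<And>i m j. f i m j \<ge> 0"
    and blocks: "\<And>i G. finite G \<Longrightarrow> G \<subseteq> B i \<Longrightarrow> (\<Sum>j\<in>{1..len i}. \<Sum>m\<in>G. f i m j) \<le> h i"
    and total: "\<And>K. (\<Sum>i<K. h i) \<le> H"
  shows "sum \<phi> Q \<le> H"
proof -
  define R where "R = {q \<in> Q. \<phi> q \<noteq> 0}"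
  have R: "finite R"
    using Q by (simp add: R_def)
  have "\<forall>q\<in>R. \<exists>z. fst (snd z) \<in> B (fst z) \<and> snd (snd z) \<in> {1..len (fst z)} \<and>
      q + n = snd (snd z) + fst (snd z) \<and> \<phi> q \<le> f (fst z) (fst (snd z)) (snd (snd z))"
  proof
    fix q assume "q \<in> R"
    then obtain i m j where "m \<in> B i" "j \<in> {1..len i}" "q + n = j + m" "\<phi> q \<le> f i m j"
      using pos[of q] by (auto simp: R_def)
    then show "\<exists>z. fst (snd z) \<in> B (fst z) \<and> snd (snd z) \<in> {1..len (fst z)} \<and>
      q + n = snd (snd z) + fst (snd z) \<and> \<phi> q \<le> f (fst z) (fst (snd z)) (snd (snd z))"
      by (intro exI[of _ "(i, m, j)"]) simp
  qed
  then obtain z where z: "\<forall>q\<in>R. fst (snd (z q)) \<in> B (fst (z q)) \<and> snd (snd (z q)) \<in> {1..len (fst (z q))} \<and>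
      q + n = snd (snd (z q)) + fst (snd (z q)) \<and> \<phi> q \<le> f (fst (z q)) (fst (snd (z q))) (snd (snd (z q)))"
    by (rule bchoice[THEN exE])
  have inj: "inj_on z R"
    by (rule inj_onI) (use z in \<open>metis add_right_cancel\<close>)
  define G where "G i = (\<lambda>q. fst (snd (z q))) ` {q \<in> R. fst (z q) = i}" for i
  have G: "finite (G i)" "G i \<subseteq> B i" for i
    using R z by (auto simp: G_def)
  obtain K where K: "(\<lambda>q. fst (z q)) ` R \<subseteq> {..<K}"
    using finite_nat_bounded R by blast
  have "sum \<phi> Q = sum \<phi> R"
    unfolding R_def using Q by (intro sum.mono_neutral_right) auto
  also have "\<dots> \<le> (\<Sum>q\<in>R. case z q of (i, m, j) \<Rightarrow> f i m j)"
    using z by (intro sum_mono) (auto simp: case_prod_beta)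
  also have "\<dots> = (\<Sum>(i, m, j)\<in>z ` R. f i m j)"
    by (simp add: sum.reindex[OF inj])
  also have "\<dots> \<le> (\<Sum>(i, m, j)\<in>(SIGMA i:{..<K}. G i \<times> {1..len i}). f i m j)"
  proof (rule sum_mono2)
    show "z ` R \<subseteq> (SIGMA i:{..<K}. G i \<times> {1..len i})"
    proof
      fix u assume "u \<in> z ` R"
      then obtain q where q: "q \<in> R" "u = z q" by blast
      then have "fst (snd (z q)) \<in> G (fst (z q))"
        unfolding G_def by blast
      then show "u \<in> (SIGMA i:{..<K}. G i \<times> {1..len i})"
        using z q K by (cases "z q") force
    qed
  qed (use G f0 in auto)
  also have "\<dots> = (\<Sum>i<K. \<Sum>(m, j)\<in>G i \<times> {1..len i}. f i m j)"
    using G by (subst sum.Sigma) auto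
  also have "\<dots> = (\<Sum>i<K. \<Sum>j\<in>{1..len i}. \<Sum>m\<in>G i. f i m j)"
    by (intro sum.cong refl) (subst sum.swap, simp add: sum.cartesian_product)
  also have "\<dots> \<le> (\<Sum>i<K. h i)"
    using G by (intro sum_mono blocks)
  also have "\<dots> \<le> H"
    by (rule total)
  finally show ?thesis .
qed

lemma sum_half_powers_le: "(\<Sum>i<K. (1 / 2 :: real) ^ i) \<le> 2"
  by (simp add: geometric_sum)

text \<open>
  The separation makes \<open>(i, m, j) \<mapsto> j + m\<close> injective, so prescribed values on the blocks do not
  conflict.
\<close>
lemma block_vector_exists:
  fixes c :: "nat \<Rightarrow> nat \<Rightarrow> nat \<Rightarrow> 'b::zero"
  assumes sep: "\<And>i i' m m'. m \<in> B i \<Longrightarrow> m' \<in> B i' \<Longrightarrow> m < m' \<Longrightarrow> m + len i < m'"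
    and disj: "\<And>i i'. i \<noteq> i' \<Longrightarrow> B i \<inter> B i' = {}"
  shows "\<exists>x. x 0 = 0 \<and> (\<forall>i. \<forall>m\<in>B i. \<forall>j\<in>{1..len i}. x (j + m) = c i m j) \<and>
    (\<forall>q. x q \<noteq> 0 \<longrightarrow> (\<exists>i. \<exists>m\<in>B i. \<exists>j\<in>{1..len i}. q = j + m))"
proof -
  define Z where "Z = {(i, m, j). m \<in> B i \<and> j \<in> {1..len i}}"
  define pos where "pos = (\<lambda>(i::nat, m, j). j + m :: nat)"
  have inj: "inj_on pos Z"
  proof (rule inj_onI)
    fix u v assume uv: "u \<in> Z" "v \<in> Z" "pos u = pos v"
    obtain i m j i' m' j' where u: "u = (i, m, j)" and v: "v = (i', m', j')"
      by (cases u; cases v) blast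
    have mem: "m \<in> B i" "m' \<in> B i'" "j \<in> {1..len i}" "j' \<in> {1..len i'}" "j + m = j' + m'"
      using uv by (auto simp: u v Z_def pos_def)
    have "m = m'"
      using sep[OF mem(1,2)] sep[OF mem(2,1)] mem(3-5) by (cases m m' rule: linorder_cases) auto
    moreover from this have "i = i'"
      using disj mem(1,2) by blast
    ultimately show "u = v"
      using mem(5) u v by simp
  qed
  define x where "x q = (if q \<in> pos ` Z then (case the_inv_into Z pos q of (i, m, j) \<Rightarrow> c i m j) else 0)" for q
  have "x (j + m) = c i m j" if "m \<in> B i" "j \<in> {1..len i}" for i m j
  proof -
    have "(i, m, j) \<in> Z" "pos (i, m, j) = j + m"
      using that by (auto simp: Z_def pos_def)
    then show ?thesis
      using the_inv_into_f_f[OF inj, of "(i, m, j)"] unfolding x_def by (metis (no_types, lifting) image_eqI old.prod.case)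
  qed
  moreover have "\<exists>i. \<exists>m\<in>B i. \<exists>j\<in>{1..len i}. q = j + m" if "x q \<noteq> 0" for q
  proof -
    have "q \<in> pos ` Z"
      using that by (auto simp: x_def split: if_splits)
    then obtain i m j where "m \<in> B i" "j \<in> {1..len i}" "q = j + m"
      by (auto simp: pos_def Z_def)
    then show ?thesis
      by blast
  qed
  moreover have "x 0 = 0"
  proof -
    have "0 \<notin> pos ` Z"
      by (auto simp: pos_def Z_def)
    then show ?thesis
      by (simp add: x_def)
  qed
  ultimately show ?thesis
    by blast
qed

section \<open>Sufficiency of the criterion\<close>

context shift_tuple
begin

text \<open>
  The two clauses on cross sums together give one bound, whichever of the two indices is larger.
\<close>
lemma separatingD:
  assumes "separating A \<epsilon>" "1 \<le> j" "j \<le> l" "1 \<le> k" "n \<in> A k" "s \<in> {1..N}" "t \<in> {1..N}" "s \<noteq> t"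
    "finite F" "F \<subseteq> {m \<in> A l. m > n}"
  shows "cross_sum s t j n F \<le> \<epsilon> (max k l)"
proof (cases "k \<le> l")
  case True
  have "cross_sum s t j n F \<le> \<epsilon> l"
    using assms unfolding separating_def by blast
  then show ?thesis
    using True by (simp add: max_absorb2)
next
  case False
  have "cross_sum s t j n F \<le> \<epsilon> k"
    using assms False unfolding separating_def by (meson not_le)
  then show ?thesis
    using False by (simp add: max_absorb1)
qed

text \<open>
  For the single index \<open>m\<close> and \<open>j = 1\<close>, the factor \<open>W t 1 (m - n)\<close> of \<open>W t 1 m\<close> is at most \<open>C ^ G\<close>
  if \<open>m - n \<le> G\<close>. If \<open>max k l\<close> is large, so that \<open>\<epsilon> (max k l)\<close> is small, this would make the
  \<open>p\<close>-th power of the quotient of \<open>W s (1 + m - n) n\<close> and \<open>W t (1 + m - n) n\<close> smaller than \<open>1\<close>,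
  for \<open>(s, t) = (1, 2)\<close> and for \<open>(s, t) = (2, 1)\<close>; but these two powers are inverse to each other.
\<close>
lemma separating_gaps:
  assumes sep: "separating A \<epsilon>" and lim: "\<epsilon> \<longlonglongrightarrow> 0"
  shows "\<forall>\<^sub>F L in sequentially. \<forall>k l n m.
    1 \<le> k \<longrightarrow> 1 \<le> l \<longrightarrow> max k l = L \<longrightarrow> n \<in> A k \<longrightarrow> m \<in> A l \<longrightarrow> n < m \<longrightarrow> G < m - n"
proof -
  obtain C where C: "C \<ge> 1" "\<forall>s\<in>{1..N}. \<forall>j n. norm (W s j n) \<le> C ^ n"
    using weight_prod_growth by blast
  define D where "D = (C ^ G) powr p"
  have "(\<lambda>L. \<epsilon> L * D) \<longlonglongrightarrow> 0 * D"
    by (intro tendsto_intros lim)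
  then have ev: "\<forall>\<^sub>F L in sequentially. \<epsilon> L * D < 1"
    by (rule order_tendstoD(2)) simp
  have N12: "1 \<in> {1..N}" "2 \<in> {1..N}"
    using N2 by auto
  have nz: "W s j n \<noteq> 0" if "s \<in> {1..N}" "1 \<le> j" for s j n
    using sep that by (intro weight_prod_nonzero) (auto simp: separating_def)
  have "G < m - n"
    if L: "\<epsilon> (max k l) * D < 1" and kl: "1 \<le> k" "1 \<le> l" and n: "n \<in> A k" and m: "m \<in> A l" and "n < m"
    for k l n m
  proof (rule ccontr)
    assume G: "\<not> G < m - n"
    let ?e = "\<epsilon> (max k l)"
    have one: "(norm (W s (1 + m - n) n) / norm (W t (1 + m - n) n)) powr p \<le> ?e * D"
      if st: "s \<in> {1..N}" "t \<in> {1..N}" "s \<noteq> t" for s t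
    proof -
      have "cross_sum s t 1 n {m} \<le> ?e"
        using st kl n m \<open>n < m\<close> by (intro separatingD[OF sep]) auto
      then have e: "(norm (W s (1 + m - n) n) / norm (W t 1 m)) powr p \<le> ?e"
        by (simp add: cross_sum_def)
      have split: "W t 1 m = W t 1 (m - n) * W t (1 + m - n) n"
        using \<open>n < m\<close> by (intro weight_prod_split) auto
      have "norm (W t 1 (m - n)) \<le> C ^ (m - n)"
        using C(2) st by blast
      also have "\<dots> \<le> C ^ G"
        using C(1) G by (intro power_increasing) auto
      finally have "norm (W t 1 (m - n)) powr p \<le> D"
        unfolding D_def using p1 by (intro powr_mono2) auto
      moreover have "(norm (W s (1 + m - n) n) / norm (W t (1 + m - n) n)) powr p
          = (norm (W s (1 + m - n) n) / norm (W t 1 m)) powr p * norm (W t 1 (m - n)) powr p"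
        unfolding split using nz[OF st(2), of 1 "m - n"] by (simp add: norm_mult powr_mult powr_divide)
      moreover have "0 \<le> ?e"
        using e powr_ge_zero order_trans by blast
      ultimately show ?thesis
        using e by (simp only: mult_mono powr_ge_zero)
    qed
    define r where "r = (norm (W 1 (1 + m - n) n) / norm (W 2 (1 + m - n) n)) powr p"
    have "r > 0"
      unfolding r_def using nz[of 1 "1 + m - n" n] nz[of 2 "1 + m - n" n] N12 \<open>n < m\<close> by simp
    moreover have "r < 1"
      using one[OF N12(1,2)] L by (simp add: r_def)
    moreover have "1 / r < 1"
      using one[OF N12(2,1)] L by (simp add: r_def powr_divide)
    ultimately show False
      by simp
  qed
  then show ?thesis
    using ev by (auto elim!: eventually_mono)
qed

lemma inverse_weights_summable_from:
  assumes "summable (\<lambda>n. 1 / norm (W s 1 n) powr p)" "\<forall>n. W s 1 n \<noteq> 0" "1 \<le> j"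
  shows "summable (\<lambda>n. 1 / norm (W s j n) powr p)"
proof -
  have "summable (\<lambda>n. 1 / norm (W s 1 (n + (j - 1))) powr p)"
    using assms(1) by (subst summable_iff_shift)
  then have "summable (\<lambda>n. norm (W s 1 (j - 1)) powr p * (1 / norm (W s 1 (n + (j - 1))) powr p))"
    by (rule summable_mult)
  moreover have "norm (W s 1 (j - 1)) powr p * (1 / norm (W s 1 (n + (j - 1))) powr p) = 1 / norm (W s j n) powr p" for n
    using weight_prod_add[of "w s" 1 "j - 1" n] assms(2,3) by (simp add: norm_mult powr_mult add.commute)
  ultimately show ?thesis
    by simp
qed

definition target :: "(nat \<Rightarrow> nat \<Rightarrow> nat \<Rightarrow> 'a) \<Rightarrow> (nat \<Rightarrow> nat) \<Rightarrow> nat \<Rightarrow> nat \<Rightarrow> nat \<Rightarrow> 'a" where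
  "target b len i s = (\<lambda>j. if j \<in> {1..len i} then b i s j else 0)"

lemma target_in_lp_space: "target b len i s \<in> lp_space p"
  by (rule finite_support_in_lp_space)
    (auto simp: target_def intro!: finite_subset[of _ "{1..len i}"] split: if_splits)

text \<open>
  The hypotheses say, in this order: blocks do not meet; the vector assembled from the blocks is
  in the space; at a time \<open>n \<in> B i\<close> the later blocks contribute little; the block of \<open>n\<close> produces
  the \<open>i\<close>-th target up to a small error. The bounds \<open>(1 / 2) ^ i * (1 / 2) ^ l\<close> are summable over
  \<open>l\<close> and still tend to \<open>0\<close> with \<open>i\<close> after summation.
\<close>
lemma universal_vector:
  fixes b :: "nat \<Rightarrow> nat \<Rightarrow> nat \<Rightarrow> 'a"
  assumes sep: "\<And>i i' m m'. m \<in> B i \<Longrightarrow> m' \<in> B i' \<Longrightarrow> m < m' \<Longrightarrow> m + len i < m'"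
    and disj: "\<And>i i'. i \<noteq> i' \<Longrightarrow> B i \<inter> B i' = {}"
    and conv: "\<And>i G. finite G \<Longrightarrow> G \<subseteq> B i \<Longrightarrow>
      (\<Sum>j\<in>{1..len i}. \<Sum>m\<in>G. norm (b i 1 j) powr p / norm (W 1 j m) powr p) \<le> (1 / 2) ^ i"
    and cross: "\<And>i l s n G. n \<in> B i \<Longrightarrow> s \<in> {1..N} \<Longrightarrow> finite G \<Longrightarrow> G \<subseteq> {m \<in> B l. n < m} \<Longrightarrow>
      (\<Sum>j\<in>{1..len l}. \<Sum>m\<in>G. norm (b l 1 j) powr p * (norm (W s (j + m - n) n) / norm (W 1 j m)) powr p)
        \<le> (1 / 2) ^ i * (1 / 2) ^ l"
    and diag: "\<And>i s n. n \<in> B i \<Longrightarrow> s \<in> {1..N} \<Longrightarrow>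
      (\<Sum>j\<in>{1..len i}. norm (W s j n / W 1 j n * b i 1 j - b i s j) powr p) \<le> (1 / 2) ^ i"
  shows "\<exists>x\<in>lp_space p. \<forall>i s n. n \<in> B i \<longrightarrow> s \<in> {1..N} \<longrightarrow>
    lp_norm p (\<lambda>q. orbit x s n q - target b len i s q) powr p \<le> 3 * (1 / 2) ^ i"
proof -
  have "\<exists>x. x 0 = 0 \<and> (\<forall>i. \<forall>m\<in>B i. \<forall>j\<in>{1..len i}. x (j + m) = b i 1 j / W 1 j m) \<and>
    (\<forall>q. x q \<noteq> 0 \<longrightarrow> (\<exists>i. \<exists>m\<in>B i. \<exists>j\<in>{1..len i}. q = j + m))"
    by (rule block_vector_exists) (use sep disj in blast)+
  then obtain x where x0: "x 0 = 0"
    and xval: "\<forall>i. \<forall>m\<in>B i. \<forall>j\<in>{1..len i}. x (j + m) = b i 1 j / W 1 j m"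
    and xsupp: "\<forall>q. x q \<noteq> 0 \<longrightarrow> (\<exists>i. \<exists>m\<in>B i. \<exists>j\<in>{1..len i}. q = j + m)"
    by (elim exE conjE)
  have x: "x \<in> lp_space p"
  proof (rule lp_bounded_sums(1)[where x=x, OF p1 x0])
    fix F :: "nat set" assume "finite F"
    then show "(\<Sum>q\<in>F. norm (x q) powr p) \<le> 2"
    proof (rule sum_over_blocks_le[where B=B and len=len and n=0 and h="\<lambda>i. (1 / 2) ^ i"
          and f="\<lambda>i m j. norm (b i 1 j) powr p / norm (W 1 j m) powr p"])
      fix q assume "norm (x q) powr p \<noteq> 0"
      then obtain i m j where "m \<in> B i" "j \<in> {1..len i}" "q = j + m"
        using xsupp by force
      then show "\<exists>i m j. m \<in> B i \<and> j \<in> {1..len i} \<and> q + 0 = j + m \<and>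
          norm (x q) powr p \<le> norm (b i 1 j) powr p / norm (W 1 j m) powr p"
        using xval by (intro exI[of _ i] exI[of _ m] exI[of _ j]) (auto simp: norm_divide powr_divide)
    qed (use conv sum_half_powers_le in auto)
  qed
  have "lp_norm p (\<lambda>q. orbit x s n q - target b len i s q) powr p \<le> 3 * (1 / 2) ^ i"
    if n: "n \<in> B i" and s: "s \<in> {1..N}" for i s n
  proof (rule lp_bounded_sums(2)[OF p1])
    let ?v = "\<lambda>q. orbit x s n q - target b len i s q"
    let ?I = "{1..len i}"
    have z0: "orbit x s n 0 = 0"
      using orbit_in_lp_space[OF x s] by (simp add: lp_space_def)
    then show "?v 0 = 0"
      by (simp add: target_def)
    fix F :: "nat set" assume F: "finite F"
    \<comment> \<open>On the support of the target the orbit reads the block of \<open>n\<close>.\<close>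
    have "(\<Sum>q\<in>F \<inter> ?I. norm (?v q) powr p) \<le> (\<Sum>q\<in>?I. norm (?v q) powr p)"
      by (intro sum_mono2) auto
    also have "\<dots> = (\<Sum>j\<in>?I. norm (W s j n / W 1 j n * b i 1 j - b i s j) powr p)"
      using xval n x by (intro sum.cong refl) (simp add: target_def orbit_coord)
    also have "\<dots> \<le> (1 / 2) ^ i"
      by (rule diag[OF n s])
    finally have part1: "(\<Sum>q\<in>F \<inter> ?I. norm (?v q) powr p) \<le> (1 / 2) ^ i" .
    \<comment> \<open>Elsewhere it reads blocks of later times only.\<close>
    have part2: "(\<Sum>q\<in>F - ?I. norm (?v q) powr p) \<le> 2 * (1 / 2) ^ i"
    proof (rule sum_over_blocks_le[where B="\<lambda>l. {m \<in> B l. n < m}" and len=len and n=n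
          and h="\<lambda>l. (1 / 2) ^ i * (1 / 2) ^ l"
          and f="\<lambda>l m j. norm (b l 1 j) powr p * (norm (W s (j + m - n) n) / norm (W 1 j m)) powr p"])
      fix q assume q: "q \<in> F - ?I" "norm (?v q) powr p \<noteq> 0"
      then have v: "?v q = orbit x s n q" "orbit x s n q \<noteq> 0"
        by (auto simp: target_def)
      then have q1: "1 \<le> q"
        using z0 by (cases q) auto
      then have z: "orbit x s n q = W s q n * x (q + n)"
        using x by (simp add: orbit_coord)
      then obtain l m j where lmj: "m \<in> B l" "j \<in> {1..len l}" "q + n = j + m"
        using v(2) xsupp by fastforce
      have "n < m"
      proof (rule ccontr)
        assume "\<not> n < m"
        then consider "m < n" | "m = n" by linarith
        then show False
        proof cases
          case 1
          then show False
            using sep[OF lmj(1) n 1] lmj(2,3) q1 by auto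
        next
          case 2
          then have "l = i"
            using disj lmj(1) n by blast
          then show False
            using 2 lmj(2,3) q(1) by auto
        qed
      qed
      have "norm (?v q) powr p = norm (b l 1 j) powr p * (norm (W s (j + m - n) n) / norm (W 1 j m)) powr p"
      proof -
        have "q = j + m - n"
          using lmj(3) by simp
        moreover have "?v q = W s q n * (b l 1 j / W 1 j m)"
          using v(1) z xval lmj by simp
        ultimately show ?thesis
          by (simp add: norm_mult norm_divide powr_mult powr_divide)
      qed
      then show "\<exists>l m j. m \<in> {m \<in> B l. n < m} \<and> j \<in> {1..len l} \<and> q + n = j + m \<and>
        norm (?v q) powr p \<le> norm (b l 1 j) powr p * (norm (W s (j + m - n) n) / norm (W 1 j m)) powr p"
        using lmj \<open>n < m\<close> by (intro exI[of _ l] exI[of _ m] exI[of _ j]) auto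
    next
      show "(\<Sum>l<K. (1 / 2) ^ i * (1 / 2) ^ l) \<le> 2 * (1 / 2 :: real) ^ i" for K
        unfolding sum_distrib_left[symmetric] using sum_half_powers_le[of K] by (simp add: mult.commute)
    qed (use F cross[OF n s] in auto)
    have "(\<Sum>q\<in>F. norm (?v q) powr p)
        = (\<Sum>q\<in>F \<inter> ?I. norm (?v q) powr p) + (\<Sum>q\<in>F - ?I. norm (?v q) powr p)"
      by (rule sum.Int_Diff[OF F])
    then show "(\<Sum>q\<in>F. norm (?v q) powr p) \<le> 3 * (1 / 2) ^ i"
      using part1 part2 by linarith
  qed
  then show ?thesis
    using x by blast
qed

text \<open>
  All requirements on the index \<open>L i\<close> except the one on quotients of weights hold for every large
  index, and the quotients can be prescribed at arbitrarily large indices.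
\<close>
lemma fast_hitting_sets:
  fixes b :: "nat \<Rightarrow> nat \<Rightarrow> nat \<Rightarrow> 'a" and A :: "nat \<Rightarrow> nat set"
  assumes sep: "separating A \<epsilon>" and lim: "\<epsilon> \<longlonglongrightarrow> 0"
    and ratio: "ratios_dense A"
    and b0: "\<And>i s j. b i s j \<noteq> 0" and \<tau>: "\<And>i. \<tau> i > 0"
  shows "\<exists>L. strict_mono L \<and> (\<forall>i. 1 \<le> L i \<and> len i \<le> L i \<and> \<epsilon> (L i) \<le> \<tau> i \<and>
    (\<forall>k l n m. 1 \<le> k \<longrightarrow> 1 \<le> l \<longrightarrow> max k l = L i \<longrightarrow> n \<in> A k \<longrightarrow> m \<in> A l \<longrightarrow> n < m \<longrightarrow> \<Gamma> i < m - n) \<and>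
    (\<forall>s\<in>{1..N}. s \<noteq> 1 \<longrightarrow> (\<forall>n\<in>A (L i). \<forall>j\<in>{1..len i}.
       norm (W s j n / W 1 j n - b i s j / b i 1 j) < \<tau> i)))"
proof -
  define good where "good i L \<longleftrightarrow> 1 \<le> L \<and> len i \<le> L \<and> \<epsilon> L \<le> \<tau> i \<and>
    (\<forall>k l n m. 1 \<le> k \<longrightarrow> 1 \<le> l \<longrightarrow> max k l = L \<longrightarrow> n \<in> A k \<longrightarrow> m \<in> A l \<longrightarrow> n < m \<longrightarrow> \<Gamma> i < m - n) \<and>
    (\<forall>s\<in>{1..N}. s \<noteq> 1 \<longrightarrow> (\<forall>n\<in>A L. \<forall>j\<in>{1..len i}.
       norm (W s j n / W 1 j n - b i s j / b i 1 j) < \<tau> i))" for i L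
  have ex: "\<exists>L>K. good i L" for i K
  proof -
    have "\<forall>\<^sub>F L in sequentially. \<epsilon> L < \<tau> i"
      using order_tendstoD(2)[OF lim \<tau>] .
    with separating_gaps[OF sep lim, of "\<Gamma> i"]
    have "\<forall>\<^sub>F L in sequentially. \<epsilon> L < \<tau> i \<and> (\<forall>k l n m. 1 \<le> k \<longrightarrow> 1 \<le> l \<longrightarrow> max k l = L \<longrightarrow>
        n \<in> A k \<longrightarrow> m \<in> A l \<longrightarrow> n < m \<longrightarrow> \<Gamma> i < m - n)"
      by eventually_elim blast
    then obtain L0 where L0: "\<forall>L\<ge>L0. \<epsilon> L < \<tau> i \<and> (\<forall>k l n m. 1 \<le> k \<longrightarrow> 1 \<le> l \<longrightarrow> max k l = L \<longrightarrow>
        n \<in> A k \<longrightarrow> m \<in> A l \<longrightarrow> n < m \<longrightarrow> \<Gamma> i < m - n)"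
      unfolding eventually_sequentially by blast
    define l where "l = Suc (max K (max L0 (len i)))"
    obtain L where L: "L \<ge> l" "\<forall>s\<in>{1..N}. \<forall>t\<in>{1..N}. s \<noteq> t \<longrightarrow> (\<forall>n\<in>A L. \<forall>j\<in>{1..l}.
          norm (W s j n / W t j n - b i s j / b i t j) < \<tau> i)"
      using ratio[unfolded ratios_dense_def, rule_format, of l "b i" "\<tau> i"] b0 \<tau> by (auto simp: l_def)
    have N1: "1 \<in> {1..N}"
      using N2 by simp
    have "good i L"
      unfolding good_def
    proof (intro conjI)
      show "\<forall>s\<in>{1..N}. s \<noteq> 1 \<longrightarrow> (\<forall>n\<in>A L. \<forall>j\<in>{1..len i}.
         norm (W s j n / W 1 j n - b i s j / b i 1 j) < \<tau> i)"
      proof (intro ballI impI)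
        fix s n j assume "s \<in> {1..N}" "s \<noteq> 1" "n \<in> A L" "j \<in> {1..len i}"
        moreover from this have "j \<in> {1..l}"
          by (auto simp: l_def)
        ultimately show "norm (W s j n / W 1 j n - b i s j / b i 1 j) < \<tau> i"
          using L(2) N1 by blast
      qed
      have "L \<ge> L0"
        using L(1) by (simp add: l_def)
      then show "\<epsilon> L \<le> \<tau> i"
        "\<forall>k l n m. 1 \<le> k \<longrightarrow> 1 \<le> l \<longrightarrow> max k l = L \<longrightarrow>
        n \<in> A k \<longrightarrow> m \<in> A l \<longrightarrow> n < m \<longrightarrow> \<Gamma> i < m - n"
        using L0 less_imp_le by blast+
    qed (use L(1) in \<open>auto simp: l_def\<close>)
    moreover have "L > K"
      using L(1) by (simp add: l_def)
    ultimately show ?thesis by blast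
  qed
  have "\<exists>L. \<forall>i. good i (L i) \<and> L i < L (Suc i)"
    using ex by (intro dependent_nat_choice[where P=good and Q="\<lambda>_ L L'. L < L'"]) blast+
  then obtain L where L: "\<forall>i. good i (L i) \<and> L i < L (Suc i)"
    by blast
  then have "strict_mono L" and good: "\<forall>i. good i (L i)"
    by (simp_all add: strict_mono_Suc_iff)
  then show ?thesis
    by (intro exI[of _ L] conjI good[unfolded good_def])
qed

text \<open>
  The sets \<open>B i\<close> are tails of the sets \<open>A (L i)\<close>, with \<open>L i\<close> chosen for gaps \<open>\<Gamma> i\<close> and a tolerance
  \<open>\<tau> i\<close> that depend on the targets up to the \<open>i\<close>-th only. A pair of sets \<open>B i\<close>, \<open>B l\<close> is
  controlled by the larger index \<open>max i l\<close>, with the bound \<open>(1 / 4) ^ max i l \<le> (1 / 2) ^ i * (1 /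
  2) ^ l\<close>.
\<close>
lemma separating_imp_universal_vector:
  fixes b :: "nat \<Rightarrow> nat \<Rightarrow> nat \<Rightarrow> 'a" and A :: "nat \<Rightarrow> nat set"
  assumes fam: "\<A> \<in> {family_uBd, family_ud, family_ld}" and A: "\<forall>k\<ge>1. A k \<in> \<A>"
    and disjA: "disjoint_family_on A {1..}"
    and sep: "separating A \<epsilon>" and lim: "\<epsilon> \<longlonglongrightarrow> 0"
    and ratio: "ratios_dense A"
    and b0: "\<And>i s j. b i s j \<noteq> 0"
  shows "\<exists>x\<in>lp_space p. \<exists>B. (\<forall>i. B i \<in> \<A>) \<and> (\<forall>i s n. n \<in> B i \<longrightarrow> s \<in> {1..N} \<longrightarrow>
    lp_norm p (\<lambda>q. orbit x s n q - target b len i s q) powr p \<le> 3 * (1 / 2) ^ i)"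
proof -
  have N1: "1 \<in> {1..N}"
    using N2 by simp
  have nz: "W s j n \<noteq> 0" if "s \<in> {1..N}" "1 \<le> j" for s j n
    using sep that by (intro weight_prod_nonzero) (auto simp: separating_def)
  define \<beta> where "\<beta> i j = norm (b i 1 j) powr p" for i j
  define \<Phi> where "\<Phi> i m = (\<Sum>j\<in>{1..len i}. \<beta> i j / norm (W 1 j m) powr p)" for i m
  define S where "S i = (\<Sum>j\<in>{1..len i}. \<beta> i j)" for i
  have \<beta>0: "\<beta> i j \<ge> 0" for i j
    by (simp add: \<beta>_def)
  have S0: "S i \<ge> 0" for i
    unfolding S_def by (intro sum_nonneg \<beta>0)
  have \<Phi>0: "\<Phi> i m \<ge> 0" for i m
    unfolding \<Phi>_def by (intro sum_nonneg divide_nonneg_nonneg \<beta>0) auto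
  have "summable (\<Phi> i)" for i
  proof -
    have W1: "(\<forall>n. W 1 1 n \<noteq> 0) \<and> summable (\<lambda>n. 1 / norm (W 1 1 n) powr p)"
      by (rule bspec[OF sep[unfolded separating_def, THEN conjunct1] N1])
    have "summable (\<lambda>m. \<beta> i j * (1 / norm (W 1 j m) powr p))" if "j \<in> {1..len i}" for j
      by (rule summable_mult, rule inverse_weights_summable_from) (use W1 that in auto)
    then show ?thesis
      unfolding \<Phi>_def by (intro summable_sum) simp
  qed
  then have tail: "\<exists>G. \<forall>F. finite F \<longrightarrow> F \<subseteq> {G..} \<longrightarrow> sum (\<Phi> i) F \<le> e" if "e > 0" for i e
    using that \<Phi>0 by (intro summable_tail_sums_small)
  have "\<forall>i. \<exists>M. \<forall>F. finite F \<longrightarrow> F \<subseteq> {M..} \<longrightarrow> sum (\<Phi> i) F \<le> (1 / 2) ^ i"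
    by (intro allI tail) simp
  then obtain M where M: "\<forall>i F. finite F \<longrightarrow> F \<subseteq> {M i..} \<longrightarrow> sum (\<Phi> i) F \<le> (1 / 2) ^ i"
    by metis
  have "\<forall>l i. \<exists>G. \<forall>F. finite F \<longrightarrow> F \<subseteq> {G..} \<longrightarrow> sum (\<Phi> l) F \<le> (1 / 4) ^ i"
    by (intro allI tail) simp
  then obtain G where G: "\<forall>l i F. finite F \<longrightarrow> F \<subseteq> {G l i..} \<longrightarrow> sum (\<Phi> l) F \<le> (1 / 4) ^ i"
    by metis
  \<comment> \<open>A gap \<open>\<Gamma> i\<close> leaves room for the block lengths up to the \<open>i\<close>-th and makes the tails of the
    series of inverse weights, weighted with any of the targets up to the \<open>i\<close>-th, at most \<open>(1 / 4)
    ^ i\<close>.\<close>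
  define \<Gamma> where "\<Gamma> i = (\<Sum>l\<le>i. len l + G l i)" for i
  have \<Gamma>: "len l \<le> \<Gamma> i" "G l i \<le> \<Gamma> i" if "l \<le> i" for l i
    using member_le_sum[of l "{..i}" "\<lambda>l. len l + G l i"] that by (auto simp: \<Gamma>_def)
  have "\<exists>\<tau>>0. S i * \<tau> powr p \<le> (1 / 2) ^ i \<and> (\<forall>l\<le>i. S l * \<tau> \<le> (1 / 4) ^ i)" for i
  proof -
    obtain \<tau>1 where \<tau>1: "\<tau>1 > 0" "S i * \<tau>1 powr p \<le> (1 / 2) ^ i"
      using small_powr_exists[OF S0, of "(1 / 2) ^ i" p] p1 by auto
    define \<tau>2 where "\<tau>2 = (1 / 4) ^ i / ((\<Sum>l\<le>i. S l) + 1)"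
    have pos: "(\<Sum>l\<le>i. S l) + 1 > 0"
      using sum_nonneg[of "{..i}" S] S0 by (simp add: add_nonneg_pos)
    have le1: "S l * \<tau>2 \<le> (1 / 4) ^ i" if "l \<le> i" for l
    proof -
      have "S l \<le> (\<Sum>l\<le>i. S l) + 1"
        using member_le_sum[of l "{..i}" S] that S0 by simp
      then have "S l * \<tau>2 \<le> ((\<Sum>l\<le>i. S l) + 1) * \<tau>2"
        using pos by (intro mult_right_mono) (auto simp: \<tau>2_def)
      then show ?thesis
        using pos by (simp add: \<tau>2_def)
    qed
    have le2: "S l * min \<tau>1 \<tau>2 \<le> (1 / 4) ^ i" if "l \<le> i" for l
      using le1[OF that] mult_left_mono[of "min \<tau>1 \<tau>2" \<tau>2 "S l"] S0[of l] by linarith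
    have "\<tau>2 > 0"
      using pos by (simp add: \<tau>2_def)
    moreover from this have "S i * min \<tau>1 \<tau>2 powr p \<le> S i * \<tau>1 powr p"
      using \<tau>1(1) p1 S0 by (intro mult_left_mono powr_mono2) auto
    ultimately show ?thesis
      using \<tau>1 le2 by (intro exI[of _ "min \<tau>1 \<tau>2"]) auto
  qed
  then obtain \<tau> where \<tau>: "\<tau> i > 0" "S i * \<tau> i powr p \<le> (1 / 2) ^ i" "l \<le> i \<Longrightarrow> S l * \<tau> i \<le> (1 / 4) ^ i" for i l
    by metis
  obtain L where mono: "strict_mono L" and L: "\<forall>i. 1 \<le> L i \<and> len i \<le> L i \<and> \<epsilon> (L i) \<le> \<tau> i \<and>
    (\<forall>k l n m. 1 \<le> k \<longrightarrow> 1 \<le> l \<longrightarrow> max k l = L i \<longrightarrow> n \<in> A k \<longrightarrow> m \<in> A l \<longrightarrow> n < m \<longrightarrow> \<Gamma> i < m - n) \<and>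
    (\<forall>s\<in>{1..N}. s \<noteq> 1 \<longrightarrow> (\<forall>n\<in>A (L i). \<forall>j\<in>{1..len i}.
       norm (W s j n / W 1 j n - b i s j / b i 1 j) < \<tau> i))"
    using fast_hitting_sets[where b=b and \<tau>=\<tau> and len=len and \<Gamma>=\<Gamma>, OF sep lim ratio b0 \<tau>(1)] by (elim exE conjE)
  have maxL: "max (L i) (L l) = L (max i l)" for i l
    using mono by (simp add: max_def strict_mono_less_eq)
  define B where "B i = A (L i) \<inter> {M i..}" for i
  have B_fam: "B i \<in> \<A>" for i
    unfolding B_def using A L by (intro density_family_tail[OF fam]) auto
  have gap: "\<Gamma> (max i l) < m - n" if "n \<in> B i" "m \<in> B l" "n < m" for i l n m
  proof -
    have "n \<in> A (L i)" "m \<in> A (L l)"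
      using that by (auto simp: B_def)
    then show ?thesis
      using L[rule_format, of "max i l"] L[rule_format, of i] L[rule_format, of l] maxL[of i l] that(3) by blast
  qed
  have "\<exists>x\<in>lp_space p. \<forall>i s n. n \<in> B i \<longrightarrow> s \<in> {1..N} \<longrightarrow>
    lp_norm p (\<lambda>q. orbit x s n q - target b len i s q) powr p \<le> 3 * (1 / 2) ^ i"
  proof (rule universal_vector)
    show "m + len i < m'" if "m \<in> B i" "m' \<in> B i'" "m < m'" for i i' m m'
      using gap[OF that] \<Gamma>(1)[of i "max i i'"] by simp
    show "B i \<inter> B i' = {}" if "i \<noteq> i'" for i i'
    proof -
      have "L i \<noteq> L i'"
        using mono that by (simp add: strict_mono_eq)
      then have "A (L i) \<inter> A (L i') = {}"
        using disjA L unfolding disjoint_family_on_def by simp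
      then show ?thesis
        by (auto simp: B_def)
    qed
    show "(\<Sum>j\<in>{1..len i}. \<Sum>m\<in>F. norm (b i 1 j) powr p / norm (W 1 j m) powr p) \<le> (1 / 2) ^ i"
      if "finite F" "F \<subseteq> B i" for i F
    proof -
      have "(\<Sum>j\<in>{1..len i}. \<Sum>m\<in>F. norm (b i 1 j) powr p / norm (W 1 j m) powr p) = sum (\<Phi> i) F"
        unfolding \<Phi>_def \<beta>_def by (rule sum.swap)
      also have "\<dots> \<le> (1 / 2) ^ i"
        using that by (intro M[rule_format]) (auto simp: B_def)
      finally show ?thesis .
    qed
    show "(\<Sum>j\<in>{1..len l}. \<Sum>m\<in>F. norm (b l 1 j) powr p *
        (norm (W s (j + m - n) n) / norm (W 1 j m)) powr p) \<le> (1 / 2) ^ i * (1 / 2) ^ l"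
      if n: "n \<in> B i" and s: "s \<in> {1..N}" and F: "finite F" "F \<subseteq> {m \<in> B l. n < m}" for i l s n F
    proof -
      let ?r = "max i l"
      have "(\<Sum>j\<in>{1..len l}. \<Sum>m\<in>F. norm (b l 1 j) powr p *
        (norm (W s (j + m - n) n) / norm (W 1 j m)) powr p) \<le> (1 / 4) ^ ?r"
      proof (cases "s = 1")
        case True
        have "(\<Sum>j\<in>{1..len l}. \<Sum>m\<in>F. norm (b l 1 j) powr p *
            (norm (W s (j + m - n) n) / norm (W 1 j m)) powr p)
          = (\<Sum>j\<in>{1..len l}. \<Sum>m\<in>F. \<beta> l j / norm (W 1 j (m - n)) powr p)"
        proof (intro sum.cong refl)
          fix j m assume j: "j \<in> {1..len l}" and "m \<in> F"
          then have "n < m" using F by auto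
          then have "W 1 j m = W 1 j (m - n) * W 1 (j + m - n) n"
            using j by (intro weight_prod_split) auto
          moreover have "W 1 (j + m - n) n \<noteq> 0"
            using j \<open>n < m\<close> N1 by (intro nz) auto
          ultimately show "norm (b l 1 j) powr p * (norm (W s (j + m - n) n) / norm (W 1 j m)) powr p
              = \<beta> l j / norm (W 1 j (m - n)) powr p"
            using True by (simp add: \<beta>_def norm_mult powr_divide)
        qed
        \<comment> \<open>For \<open>s = 1\<close> the sum is a part of the series of inverse weights, beyond the gap.\<close>
        also have "\<dots> = (\<Sum>m\<in>F. \<Phi> l (m - n))"
          unfolding \<Phi>_def by (rule sum.swap)
        also have "\<dots> = sum (\<Phi> l) ((\<lambda>m. m - n) ` F)"
        proof (subst sum.reindex)
          show "inj_on (\<lambda>m. m - n) F"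
            by (rule inj_onI) (use F in force)
        qed simp
        also have "\<dots> \<le> (1 / 4) ^ ?r"
        proof (rule G[rule_format])
          show "(\<lambda>m. m - n) ` F \<subseteq> {G l ?r..}"
            using gap[OF n] F \<Gamma>(2)[of l ?r] by fastforce
        qed (use F in auto)
        finally show ?thesis .
      next
        case False
        have "(\<Sum>j\<in>{1..len l}. \<Sum>m\<in>F. norm (b l 1 j) powr p *
            (norm (W s (j + m - n) n) / norm (W 1 j m)) powr p)
          = (\<Sum>j\<in>{1..len l}. \<beta> l j * cross_sum s 1 j n F)"
          by (simp add: \<beta>_def cross_sum_def sum_distrib_left)
        also have "\<dots> \<le> (\<Sum>j\<in>{1..len l}. \<beta> l j * \<tau> ?r)"
        proof (intro sum_mono mult_left_mono \<beta>0)
          fix j assume j: "j \<in> {1..len l}"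
          have "cross_sum s 1 j n F \<le> \<epsilon> (max (L i) (L l))"
          proof (rule separatingD[OF sep])
            show "j \<le> L l" "1 \<le> L i"
              using j L[rule_format, of l] L[rule_format, of i] by auto
          qed (use j n F s False N1 in \<open>auto simp: B_def\<close>)
          then show "cross_sum s 1 j n F \<le> \<tau> ?r"
            using L[rule_format, of ?r] unfolding maxL by linarith
        qed
        also have "\<dots> = S l * \<tau> ?r"
          by (simp add: S_def sum_distrib_right)
        also have "\<dots> \<le> (1 / 4) ^ ?r"
          by (rule \<tau>(3)) simp
        finally show ?thesis .
      qed
      also have "(1 / 4 :: real) ^ ?r = (1 / 2) ^ ?r * (1 / 2) ^ ?r"
        by (simp add: power_mult_distrib[symmetric])
      also have "\<dots> \<le> (1 / 2) ^ i * (1 / 2) ^ l"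
        by (intro mult_mono power_decreasing) auto
      finally show ?thesis .
    qed
    show "(\<Sum>j\<in>{1..len i}. norm (W s j n / W 1 j n * b i 1 j - b i s j) powr p) \<le> (1 / 2) ^ i"
      if n: "n \<in> B i" and s: "s \<in> {1..N}" for i s n
    proof (cases "s = 1")
      case True
      have "W s j n / W 1 j n * b i 1 j - b i s j = 0" if "j \<in> {1..len i}" for j
        using True nz[OF N1, of j n] that by simp
      then show ?thesis
        by simp
    next
      case False
      have "(\<Sum>j\<in>{1..len i}. norm (W s j n / W 1 j n * b i 1 j - b i s j) powr p)
          \<le> (\<Sum>j\<in>{1..len i}. \<beta> i j * \<tau> i powr p)"
      proof (rule sum_mono)
        fix j assume j: "j \<in> {1..len i}"
        have "W s j n / W 1 j n * b i 1 j - b i s j = b i 1 j * (W s j n / W 1 j n - b i s j / b i 1 j)"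
          using b0[of i 1 j] by (simp add: right_diff_distrib)
        moreover have "norm (W s j n / W 1 j n - b i s j / b i 1 j) < \<tau> i"
          using L[rule_format, of i] s False n j by (auto simp: B_def)
        ultimately have "norm (W s j n / W 1 j n * b i 1 j - b i s j) powr p \<le> (norm (b i 1 j) * \<tau> i) powr p"
          using p1 by (intro powr_mono2) (auto simp: norm_mult intro!: mult_left_mono)
        then show "norm (W s j n / W 1 j n * b i 1 j - b i s j) powr p \<le> \<beta> i j * \<tau> i powr p"
          using \<tau>(1)[of i] by (simp add: powr_mult \<beta>_def)
      qed
      also have "\<dots> = S i * \<tau> i powr p"
        by (simp add: S_def sum_distrib_right)
      also have "\<dots> \<le> (1 / 2) ^ i"
        by (rule \<tau>(2))
      finally show ?thesis .
    qed
  qed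
  then show ?thesis
    using B_fam by blast
qed

lemma lp_norm_le_from_powr:
  assumes "lp_norm p x powr p \<le> c powr p" "c \<ge> 0"
  shows "lp_norm p x \<le> c"
  using assms p1 powr_less_mono2[of p c "lp_norm p x"] by force

text \<open>
  Cut the given vectors off at a common length and approximate the finitely many remaining
  coordinates.
\<close>
lemma targets_dense:
  fixes b :: "nat \<Rightarrow> nat \<Rightarrow> nat \<Rightarrow> 'a"
  assumes dense: "\<forall>l N a e K. e > 0 \<longrightarrow>
        (\<exists>i\<ge>K. len i = l \<and> (\<forall>s\<le>N. \<forall>j\<le>l. norm (b i s j - a s j) < e))"
    and z: "\<And>s. s \<in> {1..N} \<Longrightarrow> z s \<in> lp_space p" and r: "r > 0"
  shows "\<exists>i\<ge>K. \<forall>s\<in>{1..N}. lp_norm p (\<lambda>q. target b len i s q - z s q) \<le> r"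
proof -
  have "\<exists>G. \<forall>F. finite F \<longrightarrow> F \<subseteq> {G..} \<longrightarrow> (\<Sum>q\<in>F. norm (z s q) powr p) \<le> r powr p / 2" if "s \<in> {1..N}" for s
    using z[OF that] r by (intro summable_tail_sums_small) (auto simp: lp_space_def)
  then have "\<forall>s\<in>{1..N}. \<exists>G. \<forall>F. finite F \<longrightarrow> F \<subseteq> {G..} \<longrightarrow> (\<Sum>q\<in>F. norm (z s q) powr p) \<le> r powr p / 2"
    by blast
  then obtain G where G: "\<forall>s\<in>{1..N}. \<forall>F. finite F \<longrightarrow> F \<subseteq> {G s..} \<longrightarrow> (\<Sum>q\<in>F. norm (z s q) powr p) \<le> r powr p / 2"
    by (rule bchoice[THEN exE])
  define l where "l = (\<Sum>s\<in>{1..N}. G s)"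
  have Gl: "G s \<le> l" if "s \<in> {1..N}" for s
    unfolding l_def using that by (intro member_le_sum) auto
  obtain e where e: "e > 0" "real l * e powr p \<le> r powr p / 2"
    using small_powr_exists[of "real l" "r powr p / 2" p] r p1 by auto
  obtain i where i: "i \<ge> K" "len i = l" "\<forall>s\<le>N. \<forall>j\<le>l. norm (b i s j - z s j) < e"
    using dense[rule_format, OF e(1), of K l N z] by blast
  have "lp_norm p (\<lambda>q. target b len i s q - z s q) \<le> r" if s: "s \<in> {1..N}" for s
  proof (rule lp_norm_le_from_powr)
    let ?v = "\<lambda>q. target b len i s q - z s q"
    have z0: "z s 0 = 0"
      using z[OF s] by (simp add: lp_space_def)
    show "lp_norm p ?v powr p \<le> r powr p"
    proof (rule lp_bounded_sums(2)[OF p1])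
      show "?v 0 = 0"
        using z0 by (simp add: target_def)
      fix F :: "nat set" assume F: "finite F"
      have "(\<Sum>q\<in>F \<inter> {1..l}. norm (?v q) powr p) \<le> (\<Sum>q\<in>{1..l}. norm (?v q) powr p)"
        by (intro sum_mono2) auto
      also have "\<dots> \<le> (\<Sum>q\<in>{1..l}. e powr p)"
        using i s p1 by (intro sum_mono powr_mono2) (auto simp: target_def less_imp_le)
      also have "\<dots> \<le> r powr p / 2"
        using e(2) by simp
      finally have part1: "(\<Sum>q\<in>F \<inter> {1..l}. norm (?v q) powr p) \<le> r powr p / 2" .
      have "(\<Sum>q\<in>F - {1..l}. norm (?v q) powr p) = (\<Sum>q\<in>F - {1..l}. norm (z s q) powr p)"
        using i(2) by (intro sum.cong) (auto simp: target_def)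
      also have "\<dots> = (\<Sum>q\<in>F - {1..l} - {0}. norm (z s q) powr p)"
        using F z0 by (intro sum.mono_neutral_right) auto
      also have "\<dots> \<le> r powr p / 2"
        using F Gl[OF s] by (intro G[rule_format, OF s]) auto
      finally have part2: "(\<Sum>q\<in>F - {1..l}. norm (?v q) powr p) \<le> r powr p / 2" .
      have "(\<Sum>q\<in>F. norm (?v q) powr p)
          = (\<Sum>q\<in>F \<inter> {1..l}. norm (?v q) powr p) + (\<Sum>q\<in>F - {1..l}. norm (?v q) powr p)"
        by (rule sum.Int_Diff[OF F])
      then show "(\<Sum>q\<in>F. norm (?v q) powr p) \<le> r powr p"
        using part1 part2 by linarith
    qed
  qed (use r in simp)
  then show ?thesis
    using i(1) by blast
qed

lemma separating_imp_disjoint_hypercyclic: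
  fixes A :: "nat \<Rightarrow> nat set"
  assumes fam: "\<A> \<in> {family_uBd, family_ud, family_ld}" and A: "\<forall>k\<ge>1. A k \<in> \<A>"
    and disjA: "disjoint_family_on A {1..}"
    and sep: "separating A \<epsilon>" and lim: "\<epsilon> \<longlonglongrightarrow> 0"
    and ratio: "ratios_dense A"
  shows "disjoint_hypercyclic \<A> (lp_topology p) N (\<lambda>s. backward_shift (w s))"
proof -
  interpret MS: Metric_space "lp_space p :: (nat \<Rightarrow> 'a) set" "lp_dist p"
    by (rule Metric_space_lp[OF p1])
  obtain b :: "nat \<Rightarrow> nat \<Rightarrow> nat \<Rightarrow> 'a" and len where b0: "\<forall>i s j. b i s j \<noteq> 0"
    and dense: "\<forall>l N a e K. e > 0 \<longrightarrow>
        (\<exists>i\<ge>K. len i = l \<and> (\<forall>s\<le>N. \<forall>j\<le>l. norm (b i s j - a s j) < e))"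
    using nonzero_dense_tables[where 'a='a] by (elim exE conjE)
  obtain x B where x: "x \<in> lp_space p" and B: "\<forall>i. B i \<in> \<A>"
    and near: "\<forall>i s n. n \<in> B i \<longrightarrow> s \<in> {1..N} \<longrightarrow>
      lp_norm p (\<lambda>q. orbit x s n q - target b len i s q) powr p \<le> 3 * (1 / 2) ^ i"
    using separating_imp_universal_vector[where b=b and len=len, OF fam A disjA sep lim ratio b0[rule_format]]
    by (elim bexE exE conjE)
  have "{n. 1 \<le> n \<and> (\<forall>s\<in>{1..N}. (backward_shift (w s) ^^ n) x \<in> V s)} \<in> \<A>"
    if V: "\<forall>s\<in>{1..N}. openin (lp_topology p) (V s) \<and> V s \<noteq> {}" for V
  proof -
    have "\<exists>z r. 0 < r \<and> z \<in> lp_space p \<and> MS.mball z r \<subseteq> V s" if s: "s \<in> {1..N}" for s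
    proof -
      have "openin MS.mtopology (V s)" "V s \<noteq> {}"
        using V s by (auto simp: lp_topology_def)
      then show ?thesis
        unfolding MS.openin_mtopology by blast
    qed
    then have "\<forall>s\<in>{1..N}. \<exists>zr. 0 < snd zr \<and> fst zr \<in> lp_space p \<and> MS.mball (fst zr) (snd zr) \<subseteq> V s"
      by simp
    then obtain zr where zr: "\<forall>s\<in>{1..N}. 0 < snd (zr s) \<and> fst (zr s) \<in> lp_space p \<and>
        MS.mball (fst (zr s)) (snd (zr s)) \<subseteq> V s"
      by (rule bchoice[THEN exE])
    obtain r where r: "r > 0" "\<forall>s\<in>{1..N}. r \<le> snd (zr s)"
      using finite_positive_lower_bound[of "{1..N}" "\<lambda>s. snd (zr s)"] zr by auto
    have "(\<lambda>i. 3 * (1 / 2 :: real) ^ i) \<longlonglongrightarrow> 3 * 0"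
      by (intro tendsto_intros LIMSEQ_power_zero) auto
    then have "\<forall>\<^sub>F i in sequentially. 3 * (1 / 2) ^ i < (r / 3) powr p"
      by (rule order_tendstoD(2)) (use r(1) in simp)
    then obtain K where K: "\<forall>i\<ge>K. 3 * (1 / 2) ^ i < (r / 3) powr p"
      unfolding eventually_sequentially by blast
    obtain i where i: "i \<ge> K" "\<forall>s\<in>{1..N}. lp_norm p (\<lambda>q. target b len i s q - fst (zr s) q) \<le> r / 3"
      using targets_dense[OF dense, of "\<lambda>s. fst (zr s)" "r / 3" K] zr r(1) by auto
    have hit: "orbit x s n \<in> V s" if n: "n \<in> B i" and s: "s \<in> {1..N}" for n s
    proof -
      let ?z = "fst (zr s)"
      have z: "?z \<in> lp_space p"
        using zr s by blast
      have "lp_norm p (\<lambda>q. orbit x s n q - target b len i s q) powr p \<le> (r / 3) powr p"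
        using near n s K i(1) by (meson less_imp_le order_trans)
      then have "lp_norm p (\<lambda>q. orbit x s n q - target b len i s q) \<le> r / 3"
        using r(1) by (intro lp_norm_le_from_powr) auto
      moreover have "lp_norm p (\<lambda>q. target b len i s q - ?z q) \<le> r / 3"
        using i(2) s by blast
      moreover have "lp_dist p (orbit x s n) ?z \<le> lp_dist p (orbit x s n) (target b len i s) + lp_dist p (target b len i s) ?z"
        by (intro MS.triangle orbit_in_lp_space x s target_in_lp_space z)
      ultimately have "lp_dist p ?z (orbit x s n) < snd (zr s)"
        using r s unfolding MS.commute[of ?z] by (force simp: lp_dist_def)
      then have "orbit x s n \<in> MS.mball ?z (snd (zr s))"
        using z orbit_in_lp_space[OF x s] by (simp add: MS.in_mball)
      then show ?thesis
        using zr s by blast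
    qed
    have Bi: "B i \<subseteq> {1..}"
      using B[rule_format, of i] fam by (auto simp: family_uBd_def family_ud_def family_ld_def)
    show ?thesis
    proof (rule density_family_superset[OF fam B[rule_format, of i]])
      show "B i \<subseteq> {n. 1 \<le> n \<and> (\<forall>s\<in>{1..N}. (backward_shift (w s) ^^ n) x \<in> V s)}"
        using Bi hit unfolding orbit_def by blast
    qed auto
  qed
  then show ?thesis
    unfolding disjoint_hypercyclic_def using x by (auto simp: topspace_lp_topology[OF p1])
qed

end

theorem theorem2p9:
  fixes N :: nat and p :: real
    and w :: "nat \<Rightarrow> nat \<Rightarrow> 'a::{real_normed_field, euclidean_space}"
    and \<A> :: "nat set set"
  assumes "N \<ge> 2" and "1 \<le> p"
    and "\<And>s. s \<in> {1..N} \<Longrightarrow> bounded (w s ` {1..})"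
    and "\<A> \<in> {family_uBd, family_ud, family_ld}"
  shows "disjoint_hypercyclic \<A> (lp_topology p) N (\<lambda>s. backward_shift (w s)) \<longleftrightarrow>
    (\<exists>(A :: nat \<Rightarrow> nat set) (\<epsilon> :: nat \<Rightarrow> real).
      (\<forall>k\<ge>1. A k \<in> \<A>) \<and> disjoint_family_on A {1..} \<and>
      (\<forall>k\<ge>1. \<epsilon> k > 0) \<and> \<epsilon> \<longlonglongrightarrow> 0 \<and>
      (\<forall>s\<in>{1..N}. (\<Sum>\<^sub>\<infinity>n\<in>{1..}. 1 / weight_pow p (w s) 1 n) < \<infinity>) \<and>
      (\<forall>j l k. 1 \<le> j \<and> j \<le> l \<and> 1 \<le> k \<longrightarrow>
        (\<forall>n\<in>A k. \<forall>s\<in>{1..N}. \<forall>t\<in>{1..N}. s \<noteq> t \<longrightarrow>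
          (\<Sum>\<^sub>\<infinity>m\<in>{m \<in> A l. m > n}. weight_pow p (w s) (j + m - n) n / weight_pow p (w t) j m)
            \<le> ennreal (\<epsilon> l))) \<and>
      (\<forall>j k l. 1 \<le> j \<and> j \<le> k \<and> k < l \<longrightarrow>
        (\<forall>n\<in>A l. \<forall>s\<in>{1..N}. \<forall>t\<in>{1..N}. s \<noteq> t \<longrightarrow>
          (\<Sum>\<^sub>\<infinity>m\<in>{m \<in> A k. m > n}. weight_pow p (w s) (j + m - n) n / weight_pow p (w t) j m)
            \<le> ennreal (\<epsilon> l))) \<and>
      (\<forall>l\<ge>1. \<forall>a :: nat \<Rightarrow> nat \<Rightarrow> 'a. (\<forall>s\<in>{1..N}. \<forall>j\<in>{1..l}. a s j \<noteq> 0) \<longrightarrow>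
        (\<forall>\<delta>>0. \<exists>L\<ge>l. \<forall>s\<in>{1..N}. \<forall>t\<in>{1..N}. s \<noteq> t \<longrightarrow> (\<forall>n\<in>A L. \<forall>j\<in>{1..l}.
          norm (weight_prod (w s) j n / weight_prod (w t) j n - a s j / a t j) < \<delta>))))"
    (is "?hyper \<longleftrightarrow> ?criterion")
proof -
  interpret shift_tuple N p w
    using assms(1-3) by unfold_locales
  show ?thesis
  proof
    assume ?hyper
    then obtain x where x: "x \<in> lp_space p"
      and V: "\<forall>V. (\<forall>s\<in>{1..N}. openin (lp_topology p) (V s) \<and> V s \<noteq> {}) \<longrightarrow>
        {n. 1 \<le> n \<and> (\<forall>s\<in>{1..N}. (backward_shift (w s) ^^ n) x \<in> V s)} \<in> \<A>"
      unfolding disjoint_hypercyclic_def topspace_lp_topology[OF p1] by (elim bexE)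
    obtain A :: "nat \<Rightarrow> nat set" and \<epsilon> :: "nat \<Rightarrow> real" where
      A: "\<forall>k\<ge>1. A k \<in> \<A>" "disjoint_family_on A {1..}" and pos: "\<forall>k\<ge>1. \<epsilon> k > 0" and lim: "\<epsilon> \<longlonglongrightarrow> 0"
      and sep: "separating A \<epsilon>"
      and ratio: "ratios_dense A"
      using disjoint_hypercyclic_imp_separating[OF assms(4) x V] by (elim exE conjE)
    note sums = sep[unfolded separating_iff[OF pos]]
    show ?criterion
      by (rule exI[of _ A], rule exI[of _ \<epsilon>],
          intro conjI A pos lim sums[THEN conjunct1] sums[THEN conjunct2, THEN conjunct1]
            sums[THEN conjunct2, THEN conjunct2] ratio[unfolded ratios_dense_def])
  next
    assume ?criterion
    then show ?hyper
    proof (elim exE conjE, goal_cases)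
      case (1 A \<epsilon>)
      have "separating A \<epsilon>"
        unfolding separating_iff[OF 1(3)] by (intro conjI 1(5) 1(6) 1(7))
      moreover have "ratios_dense A"
        unfolding ratios_dense_def by (rule 1(8))
      ultimately show ?case
        by (rule separating_imp_disjoint_hypercyclic[OF assms(4) 1(1,2) _ 1(4)])
    qed
  qed
qed



end
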